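(* (i) (Wilson) Let $\underline{M}$ be the $N\times N$ Wilson matrix associated (as defined in the context) with a positive integer $N$ and complex parameters $a,b,c,d$ that are admissible for $N$. If $\alpha_1=a+b+c+d$ is an integer (respectively a rational number), then the $N$ eigenvalues of $\underline{M}$ are all integers (respectively rational numbers). (ii) (Racah) Let $\underline{\tilde M}$ be the $N\times N$ Racah matrix associated (as defined in the context) with a positive integer $N$ and complex parameters $\alpha,\beta,\gamma,\delta$ that are admissible for $N$. If $\alpha+\beta$ is an integer (respectively a rational number), then the $N$ eigenvalues of $\underline{\tilde M}$ are all integers (respectively rational numbers).
   Context: $\mathbf{i}$ is the imaginary unit; $(a)_0=1$, $(a)_k=a(a+1)\cdots(a+k-1)$ for $k\ge1$. Empty products equal $1$, empty sums equal $0$. Wilson case. The Wilson polynomial is $$W_N(z;a,b,c,d)=(a+b)_N(a+c)_N(a+d)_N\sum_{k=0}^N\frac{(-N)_k(N+a+b+c+d-1)_k[a;z]_k}{k!\,(a+b)_k(a+c)_k(a+d)_k},\qquad [a;z]_k=\prod_{j=0}^{k-1}\left((a+j)^2+z\right).$$ The parameters $a,b,c,d$ are admissible for $N$ if $W_N$ is well defined by this formula ($(a+b)_N(a+c)_N(a+d)_N\ne0$), has degree exactly $N$ in $z$, and its $N$ zeros $\bar z_1,\dots,\bar z_N$ are pairwise distinct and nonzero. Choose $\bar x_s$ with $\bar x_s^2=\bar z_s$. Let $\alpha_1=a+b+c+d$, $\alpha_2=ab+ac+ad+bc+bd+cd$, $\alpha_3=bcd+acd+abd+abc$, $\alpha_4=abcd$,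 $A(x)=\alpha_4+\mathbf{i}\alpha_3x-\alpha_2x^2-\mathbf{i}\alpha_1x^3+x^4$, and $A'$ its derivative. The Wilson matrix $\underline M$ has entries $M_{nm}=\Phi_{nm}(\bar x_1,\dots,\bar x_N)+\Phi_{nm}(-\bar x_1,\dots,-\bar x_N)$, where $$\Phi_{nn}(u)=\frac{1}{(2u_n)^2}\left\{\left[\frac{2A(u_n)}{\mathbf{i}u_n}+\mathbf{i}A'(u_n)\right]\prod_{\ell\neq n}\left(1-\frac{1+2\mathbf{i}u_n}{u_n^2-u_\ell^2}\right)+2A(u_n)\sum_{m\neq n}\frac{\mathbf{i}u_n-(u_n^2+u_m^2)}{(u_n^2-u_m^2)^2}\prod_{\ell\neq n,m}\left(1-\frac{1+2\mathbf{i}u_n}{u_n^2-u_\ell^2}\right)\right\},$$ $$\Phi_{nm}(u)=-\frac{1}{(2u_n)^2}\,2A(u_n)\frac{\mathbf{i}u_m(1+2\mathbf{i}u_n)}{(u_n^2-u_m^2)^2}\prod_{\ell\neq n,m}\left(1-\frac{1+2\mathbf{i}u_n}{u_n^2-u_\ell^2}\right)\quad(m\ne n),$$ with all indices running over $1,\dots,N$. Racah case. The Racah polynomial is $$R_N(z;\alpha,\beta,\gamma,\delta)=\sum_{n=0}^N\frac{(-N)_n(N+\alpha+\beta+1)_n[z]_n}{n!\,(\alpha+1)_n(\beta+\delta+1)_n(\gamma+1)_n},\qquad [z]_n=\prod_{j=0}^{n-1}\left(-z+j(\gamma+\delta+1)+j^2\right).$$ Put $\theta=\frac{\gamma+\delta+1}{2}$.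 The parameters $\alpha,\beta,\gamma,\delta$ are admissible for $N$ if only one of $\alpha+1=-\nu$, $\beta+\delta+1=-\nu$, $\gamma+1=-\nu$ holds, with $\nu$ a nonnegative integer and $N\le\nu$; $R_N$ is well defined ($(\alpha+1)_N(\beta+\delta+1)_N(\gamma+1)_N\neq0$) and has degree exactly $N$ in $z$; and, writing its zeros as $\bar z_s=\bar y_s^2-\theta^2$ ($s=1,\dots,N$), the $\bar y_s^2$ are pairwise distinct and $\bar y_s\notin\{0,\pm\tfrac12\}$. Let $$\tilde D(y)=\frac{(2y+\gamma+\delta+1)(2y+\gamma-\delta+1)(2y+2\alpha-\gamma-\delta+1)(2y+2\beta-\gamma+\delta+1)}{32\,y\,(2y+1)}$$ and $\tilde D'$ its derivative. The Racah matrix $\underline{\tilde M}$ has entries $\tilde M_{nm}=\tilde\Phi_{nm}(\bar y_1,\dots,\bar y_N)+\tilde\Phi_{nm}(-\bar y_1,\dots,-\bar y_N)$, where $$\tilde\Phi_{nn}(u)=\frac12\left\{\left[\left(\frac{\tilde D(u_n)}{u_n^2}-\frac{\tilde D'(u_n)}{u_n}\right)(1+2u_n)-2\frac{\tilde D(u_n)}{u_n}\right]\prod_{\ell\ne n}\left(1+\frac{1+2u_n}{u_n^2-u_\ell^2}\right)+2\frac{\tilde D(u_n)}{u_n}(1+2u_n)\sum_{m\neq n}\frac{u_n^2+u_m^2+u_n}{(u_n^2-u_m^2)^2}\prod_{\ell\neq n,m}\left(1+\frac{1+2u_n}{u_n^2-u_\ell^2}\right)\right\},$$ $$\tilde\Phi_{nm}(u)=-\frac{1}{(u_n^2-u_m^2)^2}\frac{u_m\tilde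 D(u_n)}{u_n}(1+2u_n)^2\prod_{\ell\ne n,m}\left(1+\frac{1+2u_n}{u_n^2-u_\ell^2}\right)\quad(m\neq n),$$ with all indices running over $1,\dots,N$. *)

theory Defs
  imports "HOL-Analysis.Derivative" "Jordan_Normal_Form.Spectral_Radius"
begin

text \<open>
  Families indexed by \<open>1, \<dots>, N\<close> are functions on \<open>nat\<close>, used on \<open>{..<N}\<close> only.
  Polynomials are of type \<open>complex poly\<close> in the variable \<open>z\<close>, so that the degree and the
  zeros are those of the library.
\<close>

section \<open>Wilson polynomials\<close>

definition wilson_basis :: "complex \<Rightarrow> nat \<Rightarrow> complex poly" where
  "wilson_basis a k = (\<Prod>j<k. [:(a + of_nat j)\<^sup>2, 1:])"

definition wilson_poly ::
  "nat \<Rightarrow> complex \<Rightarrow> complex \<Rightarrow> complex \<Rightarrow> complex \<Rightarrow> complex poly" where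
  "wilson_poly N a b c d =
     Polynomial.smult (pochhammer (a + b) N * pochhammer (a + c) N * pochhammer (a + d) N)
       (\<Sum>k\<le>N. Polynomial.smult
          (pochhammer (- of_nat N) k * pochhammer (of_nat N + a + b + c + d - 1) k /
           (fact k * pochhammer (a + b) k * pochhammer (a + c) k * pochhammer (a + d) k))
          (wilson_basis a k))"

text \<open>Having \<open>N\<close> distinct roots in degree \<open>N\<close> says that the zeros, counted with
  multiplicity, are pairwise distinct.\<close>

definition wilson_admissible ::
  "nat \<Rightarrow> complex \<Rightarrow> complex \<Rightarrow> complex \<Rightarrow> complex \<Rightarrow> bool" where
  "wilson_admissible N a b c d \<longleftrightarrow>
     pochhammer (a + b) N * pochhammer (a + c) N * pochhammer (a + d) N \<noteq> 0 \<and>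
     Polynomial.degree (wilson_poly N a b c d) = N \<and>
     card {z. poly (wilson_poly N a b c d) z = 0} = N \<and>
     poly (wilson_poly N a b c d) 0 \<noteq> 0"

text \<open>\<open>x\<close> lists a choice of square roots, of arbitrary sign, of the zeros.\<close>

definition wilson_nodes ::
  "nat \<Rightarrow> complex \<Rightarrow> complex \<Rightarrow> complex \<Rightarrow> complex \<Rightarrow> (nat \<Rightarrow> complex) \<Rightarrow> bool" where
  "wilson_nodes N a b c d x \<longleftrightarrow>
     bij_betw (\<lambda>s. (x s)\<^sup>2) {..<N} {z. poly (wilson_poly N a b c d) z = 0}"

definition wilson_A ::
  "complex \<Rightarrow> complex \<Rightarrow> complex \<Rightarrow> complex \<Rightarrow> complex \<Rightarrow> complex" where
  "wilson_A a b c d x =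
     (let \<alpha>1 = a + b + c + d;
          \<alpha>2 = a * b + a * c + a * d + b * c + b * d + c * d;
          \<alpha>3 = b * c * d + a * c * d + a * b * d + a * b * c;
          \<alpha>4 = a * b * c * d
      in \<alpha>4 + \<i> * \<alpha>3 * x - \<alpha>2 * x ^ 2 - \<i> * \<alpha>1 * x ^ 3 + x ^ 4)"

definition wilson_prod :: "nat \<Rightarrow> (nat \<Rightarrow> complex) \<Rightarrow> nat \<Rightarrow> nat set \<Rightarrow> complex" where
  "wilson_prod N u n E =
     (\<Prod>l\<in>{..<N} - E. 1 - (1 + 2 * \<i> * u n) / ((u n)\<^sup>2 - (u l)\<^sup>2))"

definition wilson_Phi ::
  "nat \<Rightarrow> complex \<Rightarrow> complex \<Rightarrow> complex \<Rightarrow> complex \<Rightarrow> (nat \<Rightarrow> complex) \<Rightarrow> nat \<Rightarrow> nat \<Rightarrow> complex" where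
  "wilson_Phi N a b c d u n m =
     (let A = wilson_A a b c d in
      if m = n then
        1 / (2 * u n)\<^sup>2 *
          ((2 * A (u n) / (\<i> * u n) + \<i> * deriv A (u n)) * wilson_prod N u n {n}
           + 2 * A (u n) *
             (\<Sum>k\<in>{..<N} - {n}.
                (\<i> * u n - ((u n)\<^sup>2 + (u k)\<^sup>2)) / ((u n)\<^sup>2 - (u k)\<^sup>2)\<^sup>2 *
                wilson_prod N u n {n, k}))
      else
        - (1 / (2 * u n)\<^sup>2) * (2 * A (u n)) *
          (\<i> * u m * (1 + 2 * \<i> * u n) / ((u n)\<^sup>2 - (u m)\<^sup>2)\<^sup>2) *
          wilson_prod N u n {n, m})"

definition wilson_matrix ::
  "nat \<Rightarrow> complex \<Rightarrow> complex \<Rightarrow> complex \<Rightarrow> complex \<Rightarrow> (nat \<Rightarrow> complex) \<Rightarrow> complex mat" where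
  "wilson_matrix N a b c d x =
     Matrix.mat N N (\<lambda>(n, m). wilson_Phi N a b c d x n m + wilson_Phi N a b c d (\<lambda>s. - x s) n m)"


section \<open>Racah polynomials\<close>

definition racah_basis :: "complex \<Rightarrow> complex \<Rightarrow> nat \<Rightarrow> complex poly" where
  "racah_basis \<gamma> \<delta> k = (\<Prod>j<k. [:of_nat j * (\<gamma> + \<delta> + 1) + (of_nat j)\<^sup>2, - 1:])"

definition racah_poly ::
  "nat \<Rightarrow> complex \<Rightarrow> complex \<Rightarrow> complex \<Rightarrow> complex \<Rightarrow> complex poly" where
  "racah_poly N \<alpha> \<beta> \<gamma> \<delta> =
     (\<Sum>k\<le>N. Polynomial.smult
        (pochhammer (- of_nat N) k * pochhammer (of_nat N + \<alpha> + \<beta> + 1) k /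
         (fact k * pochhammer (\<alpha> + 1) k * pochhammer (\<beta> + \<delta> + 1) k * pochhammer (\<gamma> + 1) k))
        (racah_basis \<gamma> \<delta> k))"

definition racah_theta :: "complex \<Rightarrow> complex \<Rightarrow> complex" where
  "racah_theta \<gamma> \<delta> = (\<gamma> + \<delta> + 1) / 2"

text \<open>Exactly one of the three truncation conditions holds, for a common \<open>\<nu> \<ge> N\<close>.\<close>

definition racah_truncation ::
  "nat \<Rightarrow> complex \<Rightarrow> complex \<Rightarrow> complex \<Rightarrow> complex \<Rightarrow> bool" where
  "racah_truncation N \<alpha> \<beta> \<gamma> \<delta> \<longleftrightarrow>
     (\<exists>\<nu>\<ge>N.
        (\<alpha> + 1 = - of_nat \<nu> \<and> \<beta> + \<delta> + 1 \<noteq> - of_nat \<nu> \<and> \<gamma> + 1 \<noteq> - of_nat \<nu>) \<or>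
        (\<alpha> + 1 \<noteq> - of_nat \<nu> \<and> \<beta> + \<delta> + 1 = - of_nat \<nu> \<and> \<gamma> + 1 \<noteq> - of_nat \<nu>) \<or>
        (\<alpha> + 1 \<noteq> - of_nat \<nu> \<and> \<beta> + \<delta> + 1 \<noteq> - of_nat \<nu> \<and> \<gamma> + 1 = - of_nat \<nu>))"

text \<open>Since \<open>y\<^sup>2 \<mapsto> y\<^sup>2 - \<theta>\<^sup>2\<close> is injective, the values \<open>y\<^sup>2\<close> are pairwise distinct if
  and only if the zeros are.\<close>

definition racah_admissible ::
  "nat \<Rightarrow> complex \<Rightarrow> complex \<Rightarrow> complex \<Rightarrow> complex \<Rightarrow> bool" where
  "racah_admissible N \<alpha> \<beta> \<gamma> \<delta> \<longleftrightarrow>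
     racah_truncation N \<alpha> \<beta> \<gamma> \<delta> \<and>
     pochhammer (\<alpha> + 1) N * pochhammer (\<beta> + \<delta> + 1) N * pochhammer (\<gamma> + 1) N \<noteq> 0 \<and>
     Polynomial.degree (racah_poly N \<alpha> \<beta> \<gamma> \<delta>) = N \<and>
     card {z. poly (racah_poly N \<alpha> \<beta> \<gamma> \<delta>) z = 0} = N \<and>
     (\<forall>y. poly (racah_poly N \<alpha> \<beta> \<gamma> \<delta>) (y\<^sup>2 - (racah_theta \<gamma> \<delta>)\<^sup>2) = 0 \<longrightarrow>
          y \<notin> {0, 1 / 2, - 1 / 2})"

definition racah_nodes ::
  "nat \<Rightarrow> complex \<Rightarrow> complex \<Rightarrow> complex \<Rightarrow> complex \<Rightarrow> (nat \<Rightarrow> complex) \<Rightarrow> bool" where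
  "racah_nodes N \<alpha> \<beta> \<gamma> \<delta> y \<longleftrightarrow>
     bij_betw (\<lambda>s. (y s)\<^sup>2 - (racah_theta \<gamma> \<delta>)\<^sup>2) {..<N} {z. poly (racah_poly N \<alpha> \<beta> \<gamma> \<delta>) z = 0}"

definition racah_D ::
  "complex \<Rightarrow> complex \<Rightarrow> complex \<Rightarrow> complex \<Rightarrow> complex \<Rightarrow> complex" where
  "racah_D \<alpha> \<beta> \<gamma> \<delta> y =
     (2 * y + \<gamma> + \<delta> + 1) * (2 * y + \<gamma> - \<delta> + 1) *
     (2 * y + 2 * \<alpha> - \<gamma> - \<delta> + 1) * (2 * y + 2 * \<beta> - \<gamma> + \<delta> + 1) /
     (32 * y * (2 * y + 1))"

definition racah_prod :: "nat \<Rightarrow> (nat \<Rightarrow> complex) \<Rightarrow> nat \<Rightarrow> nat set \<Rightarrow> complex" where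
  "racah_prod N u n E =
     (\<Prod>l\<in>{..<N} - E. 1 + (1 + 2 * u n) / ((u n)\<^sup>2 - (u l)\<^sup>2))"

definition racah_Phi ::
  "nat \<Rightarrow> complex \<Rightarrow> complex \<Rightarrow> complex \<Rightarrow> complex \<Rightarrow> (nat \<Rightarrow> complex) \<Rightarrow> nat \<Rightarrow> nat \<Rightarrow> complex" where
  "racah_Phi N \<alpha> \<beta> \<gamma> \<delta> u n m =
     (let D = racah_D \<alpha> \<beta> \<gamma> \<delta> in
      if m = n then
        1 / 2 *
          (((D (u n) / (u n)\<^sup>2 - deriv D (u n) / u n) * (1 + 2 * u n) - 2 * (D (u n) / u n)) *
             racah_prod N u n {n}
           + 2 * (D (u n) / u n) * (1 + 2 * u n) *
             (\<Sum>k\<in>{..<N} - {n}.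
                ((u n)\<^sup>2 + (u k)\<^sup>2 + u n) / ((u n)\<^sup>2 - (u k)\<^sup>2)\<^sup>2 *
                racah_prod N u n {n, k}))
      else
        - (1 / ((u n)\<^sup>2 - (u m)\<^sup>2)\<^sup>2) * (u m * D (u n) / u n) * (1 + 2 * u n)\<^sup>2 *
          racah_prod N u n {n, m})"

definition racah_matrix ::
  "nat \<Rightarrow> complex \<Rightarrow> complex \<Rightarrow> complex \<Rightarrow> complex \<Rightarrow> (nat \<Rightarrow> complex) \<Rightarrow> complex mat" where
  "racah_matrix N \<alpha> \<beta> \<gamma> \<delta> y =
     Matrix.mat N N (\<lambda>(n, m). racah_Phi N \<alpha> \<beta> \<gamma> \<delta> y n m + racah_Phi N \<alpha> \<beta> \<gamma> \<delta> (\<lambda>s. - y s) n m)"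

end

theory Submission
  imports Defs
begin

text \<open>
  Let \<open>L\<close> be the second-order difference operator of the Wilson polynomials. It is triangular with
  respect to the degree in \<open>z = x\<^sup>2\<close>, with eigenvalues \<open>\<lambda>\<^sub>k = k (k + \<alpha>\<^sub>1 - 1)\<close>, and \<open>W\<^sub>N\<close> is an
  eigenfunction for \<open>\<lambda>\<^sub>N\<close> (\<open>wilson_L_triangular\<close>, \<open>wilson_L_wilson_poly\<close>).

  Let a monic polynomial \<open>\<psi>\<close> of degree \<open>N\<close> evolve by \<open>\<partial>\<psi>/\<partial>t = \<lambda>\<^sub>N \<psi> - L \<psi>\<close>. Its zeros \<open>x\<^sub>n\<^sup>2\<close> then move
  by a system of differential equations for the \<open>x\<^sub>n\<close>, which has the square roots of the zeros of
  \<open>W\<^sub>N\<close> as an equilibrium, and the Wilson matrix is the Jacobian matrix there. Passing from the \<open>x\<^sub>n\<close>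
  to the coefficients of \<open>\<psi>\<close>, one sees that the matrix is similar to \<open>\<lambda>\<^sub>N - L\<close> on the polynomials of
  degree less than \<open>N\<close>. Hence its eigenvalues are among the \<open>\<lambda>\<^sub>N - \<lambda>\<^sub>j\<close> with \<open>j < N\<close>.

  The proof does this on the level of eigenvectors, without the evolution. From an eigenvector \<open>v\<close>
  of the matrix for \<open>k\<close>, form \<open>q = \<Sum>\<^sub>m 2 x\<^sub>m v\<^sub>m \<Prod>\<^sub>l\<^sub>\<noteq>\<^sub>m (z - x\<^sub>l\<^sup>2)\<close>. Computing the linearization
  of \<open>L \<psi>\<close> at the nodes in two ways gives \<open>(L q)(x\<^sub>n) = (\<lambda>\<^sub>N - k) q(x\<^sub>n\<^sup>2)\<close> for every \<open>n\<close>
  (\<open>wilson_Phi_apply\<close>, \<open>wilson_L_tangent_poly\<close>). As \<open>q\<close> has degree \<open>j < N\<close>, this holds identically, and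
  the leading coefficients give \<open>\<lambda>\<^sub>j = \<lambda>\<^sub>N - k\<close>.

  The substitution \<open>x = - \<i> y\<close> turns the Racah matrix into minus a Wilson matrix whose parameters have
  the sum \<open>\<alpha> + \<beta> + 2\<close> (\<open>racah_matrix_eq\<close>).
\<close>

section \<open>The divided difference along the shift\<close>

lemma synthetic_div_eqI:
  fixes p :: "'a::comm_ring_1 poly"
  assumes "p = [:- c, 1:] * r + [:e:]"
  shows "synthetic_div p c = r"
proof -
  have "p + Polynomial.smult c r = pCons e r"
    by (simp add: assms)
  then show ?thesis
    using synthetic_div_unique by metis
qed

lemma synthetic_div_mult:
  fixes p q :: "'a::comm_ring_1 poly"
  shows "synthetic_div (p * q) c =
    synthetic_div p c * q + Polynomial.smult (poly p c) (synthetic_div q c)"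
proof (rule synthetic_div_eqI)
  let ?P = "synthetic_div p c" and ?Q = "synthetic_div q c"
  have p: "p = [:- c, 1:] * ?P + [:poly p c:]" and q: "q = [:- c, 1:] * ?Q + [:poly q c:]"
    by (simp_all only: synthetic_div_correct')
  have "p * q = [:- c, 1:] * ?P * q + [:poly p c:] * q"
    using p by (metis distrib_right)
  also have "[:poly p c:] * q = [:poly p c:] * ([:- c, 1:] * ?Q + [:poly q c:])"
    using q by metis
  finally show "p * q = [:- c, 1:] * (?P * q + Polynomial.smult (poly p c) ?Q) +
      [:poly p c * poly q c:]"
    by (simp add: algebra_simps smult_add_right smult_diff_right)
qed

lemma synthetic_div_add:
  fixes p q :: "'a::comm_ring_1 poly"
  shows "synthetic_div (p + q) c = synthetic_div p c + synthetic_div q c"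
proof (rule synthetic_div_eqI)
  let ?P = "synthetic_div p c" and ?Q = "synthetic_div q c"
  have p: "p = [:- c, 1:] * ?P + [:poly p c:]" and q: "q = [:- c, 1:] * ?Q + [:poly q c:]"
    by (simp_all only: synthetic_div_correct')
  have "p + q = ([:- c, 1:] * ?P + [:poly p c:]) + ([:- c, 1:] * ?Q + [:poly q c:])"
    using p q by metis
  then show "p + q = [:- c, 1:] * (?P + ?Q) + [:poly p c + poly q c:]"
    by (simp add: algebra_simps)
qed

text \<open>
  \<open>shift_quotient p x\<close> is the divided difference of \<open>p\<close> at \<open>(x - \<i>)\<^sup>2\<close> and \<open>x\<^sup>2\<close>, that is
  \<open>(p ((x - \<i>)\<^sup>2) - p (x\<^sup>2)) / ((x - \<i>)\<^sup>2 - x\<^sup>2)\<close> where the denominator \<open>- (1 + 2 \<i> x)\<close> is nonzero.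
  Taking the quotient by synthetic division gives it a meaning at \<open>x = \<i> / 2\<close> as well, which
  matters because \<open>-1/4\<close> may be a zero of an admissible Wilson polynomial.
\<close>

definition shift_quotient :: "complex poly \<Rightarrow> complex \<Rightarrow> complex" where
  "shift_quotient p x = poly (synthetic_div p (x\<^sup>2)) ((x - \<i>)\<^sup>2)"

lemma shift_quotient_0 [simp]: "shift_quotient 0 x = 0"
  by (simp add: shift_quotient_def)

lemma shift_quotient_const [simp]: "shift_quotient [:e:] x = 0"
  by (simp add: shift_quotient_def)

text \<open>The Leibniz rule for divided differences.\<close>

lemma shift_quotient_mult:
  "shift_quotient (p * q) x =
    shift_quotient p x * poly q ((x - \<i>)\<^sup>2) + poly p (x\<^sup>2) * shift_quotient q x"
  by (simp add: shift_quotient_def synthetic_div_mult)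

lemma shift_quotient_add:
  "shift_quotient (p + q) x = shift_quotient p x + shift_quotient q x"
  by (simp add: shift_quotient_def synthetic_div_add)

lemma shift_quotient_smult:
  "shift_quotient (Polynomial.smult e p) x = e * shift_quotient p x"
  using shift_quotient_mult[of "[:e:]" p x] by simp

lemma shift_quotient_linear [simp]: "shift_quotient [:e, 1:] x = 1"
  by (simp add: shift_quotient_def)

lemma shift_quotient_sum:
  "shift_quotient (\<Sum>i\<in>S. f i) x = (\<Sum>i\<in>S. shift_quotient (f i) x)"
  by (induction S rule: infinite_finite_induct) (simp_all add: shift_quotient_add)

lemma isCont_shift_quotient: "isCont (shift_quotient p) x"
proof (induction p)
  case 0
  then show ?case by (simp add: shift_quotient_def)
next
  case (pCons e p)
  have "shift_quotient (pCons e p) = (\<lambda>x. poly p (x\<^sup>2) + (x - \<i>)\<^sup>2 * shift_quotient p x)"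
    by (rule ext) (simp add: shift_quotient_def)
  then show ?case
    using pCons.IH by (auto intro!: continuous_intros)
qed

section \<open>The difference operator of the Wilson polynomials\<close>

lemma wilson_A_prod:
  "wilson_A a b c d x = (a + \<i> * x) * (b + \<i> * x) * (c + \<i> * x) * (d + \<i> * x)"
  by (simp add: wilson_A_def Let_def algebra_simps power2_eq_square power3_eq_cube power4_eq_xxxx)

lemma poly_wilson_basis:
  "poly (wilson_basis a k) (x\<^sup>2) = pochhammer (a + \<i> * x) k * pochhammer (a - \<i> * x) k"
proof -
  have "(a + of_nat j)\<^sup>2 + x\<^sup>2 = (a + \<i> * x + of_nat j) * (a - \<i> * x + of_nat j)" for j
    by (simp add: algebra_simps power2_eq_square)
  then show ?thesis
    by (simp add: wilson_basis_def poly_prod pochhammer_prod prod.distrib atLeast0LessThan)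
qed

lemma wilson_basis_Suc:
  "wilson_basis a (Suc k) = wilson_basis a k * [:(a + of_nat k)\<^sup>2, 1:]"
  by (simp add: wilson_basis_def)

lemma shift_quotient_wilson_basis:
  "shift_quotient (wilson_basis a (Suc k)) x =
     of_nat (Suc k) * pochhammer (a + 1 + \<i> * x) k * pochhammer (a - \<i> * x) k"
proof (induction k)
  case 0
  then show ?case by (simp add: wilson_basis_def)
next
  case (Suc k)
  define y where "y = \<i> * x"
  define P where "P = pochhammer (a + 1 + y) k"
  define R where "R = pochhammer (a - y) k"
  define e :: complex where "e = of_nat k"
  have sq: "(x - \<i>)\<^sup>2 = - (y + 1)\<^sup>2"
    by (simp add: y_def algebra_simps power2_eq_square)
  have "pochhammer (a + y) (Suc k) = (a + y) * P"
    by (simp add: pochhammer_rec P_def ac_simps)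
  moreover have "pochhammer (a - y) (Suc k) = R * (a - y + e)"
    by (simp add: pochhammer_Suc R_def e_def)
  moreover have "pochhammer (a + 1 + y) (Suc k) = P * (a + 1 + y + e)"
    by (simp add: pochhammer_Suc P_def e_def)
  ultimately show ?case
    using Suc
    unfolding wilson_basis_Suc[of a "Suc k"] shift_quotient_mult
    by (simp add: poly_wilson_basis sq flip: y_def P_def R_def e_def)
      (simp add: algebra_simps power2_eq_square)
qed

text \<open>
  The usual coefficient \<open>A x / (2 \<i> x (2 \<i> x + 1))\<close> of \<open>p ((x - \<i>)\<^sup>2) - p (x\<^sup>2)\<close>, multiplied by
  \<open>- (1 + 2 \<i> x)\<close> so that it becomes the coefficient of the divided difference.
\<close>

definition wilson_B ::
  "complex \<Rightarrow> complex \<Rightarrow> complex \<Rightarrow> complex \<Rightarrow> complex \<Rightarrow> complex" where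
  "wilson_B a b c d x = \<i> * wilson_A a b c d x / (2 * x)"

text \<open>
  The value at \<open>x\<close> of the Wilson difference operator applied to \<open>p\<close>. The argument \<open>x = 0\<close>, where
  \<open>wilson_B\<close> has its pole, is excluded in the lemmas.
\<close>

definition wilson_L ::
  "complex \<Rightarrow> complex \<Rightarrow> complex \<Rightarrow> complex \<Rightarrow> complex poly \<Rightarrow> complex \<Rightarrow> complex" where
  "wilson_L a b c d p x =
     wilson_B a b c d x * shift_quotient p x + wilson_B a b c d (- x) * shift_quotient p (- x)"

text \<open>The \<open>k\<close>-th eigenvalue of the operator, where \<open>s\<close> is the sum of the four parameters.\<close>

definition wilson_ev :: "complex \<Rightarrow> nat \<Rightarrow> complex" where
  "wilson_ev s k = of_nat k * (of_nat k + s - 1)"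

lemma wilson_L_add:
  "wilson_L a b c d (p + q) x = wilson_L a b c d p x + wilson_L a b c d q x"
  by (simp add: wilson_L_def shift_quotient_add algebra_simps)

lemma wilson_L_smult:
  "wilson_L a b c d (Polynomial.smult e p) x = e * wilson_L a b c d p x"
  by (simp add: wilson_L_def shift_quotient_smult algebra_simps)

lemma wilson_L_sum:
  "wilson_L a b c d (\<Sum>i\<in>S. f i) x = (\<Sum>i\<in>S. wilson_L a b c d (f i) x)"
  by (induction S rule: infinite_finite_induct)
    (simp_all add: wilson_L_add, simp_all add: wilson_L_def)

text \<open>
  The operator is bidiagonal in the basis of the \<open>wilson_basis a k\<close>. This makes it triangular with
  respect to the degree, and reduces the eigenvalue equation of the Wilson polynomial to the
  recurrence between consecutive coefficients of its hypergeometric sum.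
\<close>

lemma wilson_L_basis:
  assumes "x \<noteq> 0"
  shows "wilson_L a b c d (wilson_basis a (Suc k)) x =
    wilson_ev (a + b + c + d) (Suc k) * poly (wilson_basis a (Suc k)) (x\<^sup>2)
    - of_nat (Suc k) * (a + b + of_nat k) * (a + c + of_nat k) * (a + d + of_nat k) *
      poly (wilson_basis a k) (x\<^sup>2)"
proof -
  define y where "y = \<i> * x"
  define e :: complex where "e = of_nat k"
  define P where "P = pochhammer (a + 1 + y) k"
  define P' where "P' = pochhammer (a + 1 - y) k"
  define Q where "Q = pochhammer (a + y) k"
  define Q' where "Q' = pochhammer (a - y) k"
  have y0: "y \<noteq> 0" using assms by (simp add: y_def)
  have P: "(a + y) * P = Q * (a + y + e)"
    unfolding P_def Q_def e_def
    using pochhammer_rec[of "a + y" k] pochhammer_Suc[of "a + y" k] by (simp add: ac_simps)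
  have P': "(a - y) * P' = Q' * (a - y + e)"
    unfolding P'_def Q'_def e_def
    using pochhammer_rec[of "a - y" k] pochhammer_Suc[of "a - y" k] by (simp add: algebra_simps)
  have B: "2 * y * wilson_B a b c d x = - ((a + y) * (b + y) * (c + y) * (d + y))"
    "2 * y * wilson_B a b c d (- x) = (a - y) * (b - y) * (c - y) * (d - y)"
    using assms by (simp_all add: wilson_B_def wilson_A_prod y_def)
  have x2: "x\<^sup>2 = - y\<^sup>2" by (simp add: y_def power_mult_distrib)
  have "2 * y * wilson_L a b c d (wilson_basis a (Suc k)) x =
      2 * y * wilson_B a b c d x * ((1 + e) * P * Q') +
      2 * y * wilson_B a b c d (- x) * ((1 + e) * P' * Q)"
    by (simp add: wilson_L_def shift_quotient_wilson_basis distrib_left mult.assoc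
        flip: y_def P_def P'_def Q_def Q'_def e_def)
  also have "\<dots> = (1 + e) * (- ((a + y) * P) * (b + y) * (c + y) * (d + y) * Q'
        + ((a - y) * P') * (b - y) * (c - y) * (d - y) * Q)"
    unfolding B by (simp add: algebra_simps)
  also have "\<dots> = 2 * y * ((1 + e) * (1 + e + (a + b + c + d) - 1) * (Q * Q' * ((a + e)\<^sup>2 - y\<^sup>2))
      - (1 + e) * (a + b + e) * (a + c + e) * (a + d + e) * (Q * Q'))"
    unfolding P P' by (simp add: algebra_simps power2_eq_square)
  finally have "wilson_L a b c d (wilson_basis a (Suc k)) x =
      (1 + e) * (1 + e + (a + b + c + d) - 1) * (Q * Q' * ((a + e)\<^sup>2 - y\<^sup>2))
      - (1 + e) * (a + b + e) * (a + c + e) * (a + d + e) * (Q * Q')"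
    using y0 by simp
  then show ?thesis
    unfolding wilson_basis_Suc poly_mult poly_wilson_basis
    by (simp add: wilson_ev_def x2 flip: y_def Q_def Q'_def e_def)
qed

lemma wilson_L_basis_0: "wilson_L a b c d (wilson_basis a 0) x = 0"
  using shift_quotient_const[of 1] by (simp add: wilson_L_def wilson_basis_def one_pCons)

lemma wilson_basis_degree: "Polynomial.degree (wilson_basis a k) = k"
proof (induction k)
  case 0
  then show ?case by (simp add: wilson_basis_def)
next
  case (Suc k)
  have "wilson_basis a k \<noteq> 0"
    by (simp add: wilson_basis_def)
  then show ?case
    unfolding wilson_basis_Suc using Suc by (subst degree_mult_eq) auto
qed

lemma wilson_basis_monic: "Polynomial.coeff (wilson_basis a k) k = 1"
proof -
  have "Polynomial.lead_coeff (wilson_basis a k) = 1"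
    by (simp add: wilson_basis_def lead_coeff_prod)
  then show ?thesis by (simp only: wilson_basis_degree)
qed

text \<open>
  The operator acts on polynomials of degree at most \<open>k\<close> as multiplication by \<open>wilson_ev s k\<close>, up to
  terms of degree less than \<open>k\<close>.
\<close>

lemma wilson_L_triangular:
  assumes "Polynomial.degree p \<le> k"
  shows "\<exists>r. (\<forall>i\<ge>k. Polynomial.coeff r i = 0) \<and>
    (\<forall>x. x \<noteq> 0 \<longrightarrow> wilson_L a b c d p x =
       poly (Polynomial.smult (wilson_ev (a + b + c + d) k) p + r) (x\<^sup>2))"
  using assms
proof (induction k arbitrary: p)
  case 0
  then obtain e where "p = [:e:]" by (metis degree_0_id le_zero_eq)
  then show ?case by (intro exI[of _ 0]) (simp add: wilson_L_def wilson_ev_def)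
next
  case (Suc k)
  define s where "s = a + b + c + d"
  define e where "e = Polynomial.coeff p (Suc k)"
  define f where "f = of_nat (Suc k) * (a + b + of_nat k) * (a + c + of_nat k) * (a + d + of_nat k)"
  define p' where "p' = p - Polynomial.smult e (wilson_basis a (Suc k))"
  have p: "p = Polynomial.smult e (wilson_basis a (Suc k)) + p'" by (simp add: p'_def)
  have p'0: "Polynomial.coeff p' i = 0" if "i \<ge> Suc k" for i
  proof (cases "i = Suc k")
    case True
    then show ?thesis by (simp add: p'_def e_def wilson_basis_monic)
  next
    case False
    with that Suc.prems show ?thesis
      by (simp add: p'_def coeff_eq_0 wilson_basis_degree)
  qed
  then have "Polynomial.degree p' \<le> k"
    by (intro degree_le) auto
  then obtain r where r: "\<And>i. i \<ge> k \<Longrightarrow> Polynomial.coeff r i = 0"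
    "\<And>x. x \<noteq> 0 \<Longrightarrow> wilson_L a b c d p' x =
       poly (Polynomial.smult (wilson_ev s k) p' + r) (x\<^sup>2)"
    using Suc.IH unfolding s_def by blast
  define r' where "r' = Polynomial.smult (wilson_ev s k - wilson_ev s (Suc k)) p' + r
    - Polynomial.smult (e * f) (wilson_basis a k)"
  have "Polynomial.coeff r' i = 0" if "i \<ge> Suc k" for i
    using that r(1)[of i] p'0[of i]
    by (simp add: r'_def coeff_eq_0 wilson_basis_degree)
  moreover have "wilson_L a b c d p x =
      poly (Polynomial.smult (wilson_ev s (Suc k)) p + r') (x\<^sup>2)" if "x \<noteq> 0" for x
  proof -
    have "wilson_L a b c d p x =
        e * (wilson_ev s (Suc k) * poly (wilson_basis a (Suc k)) (x\<^sup>2)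
          - f * poly (wilson_basis a k) (x\<^sup>2))
        + poly (Polynomial.smult (wilson_ev s k) p' + r) (x\<^sup>2)"
      by (subst p) (simp add: wilson_L_add wilson_L_smult wilson_L_basis[OF that] r(2)[OF that]
          f_def s_def)
    then show ?thesis
      by (subst (2) p) (simp add: r'_def algebra_simps)
  qed
  ultimately show ?case unfolding s_def by blast
qed

lemma wilson_L_wilson_poly:
  assumes nz: "pochhammer (a + b) N * pochhammer (a + c) N * pochhammer (a + d) N \<noteq> 0"
    and x: "x \<noteq> 0"
  shows "wilson_L a b c d (wilson_poly N a b c d) x =
    wilson_ev (a + b + c + d) N * poly (wilson_poly N a b c d) (x\<^sup>2)"
proof -
  define s where "s = a + b + c + d"
  define C where "C k = pochhammer (- of_nat N) k * pochhammer (of_nat N + a + b + c + d - 1) k /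
           (fact k * pochhammer (a + b) k * pochhammer (a + c) k * pochhammer (a + d) k)" for k
  define F where "F k = poly (wilson_basis a k) (x\<^sup>2)" for k
  define m where "m k = of_nat (Suc k) * (a + b + of_nat k) * (a + c + of_nat k) * (a + d + of_nat k)"
    for k
  have W: "wilson_poly N a b c d =
      Polynomial.smult (pochhammer (a + b) N * pochhammer (a + c) N * pochhammer (a + d) N)
       (\<Sum>k\<le>N. Polynomial.smult (C k) (wilson_basis a k))"
    by (simp add: wilson_poly_def C_def)
  have C: "C (Suc k) * m k = C k * (wilson_ev s k - wilson_ev s N)" if "k < N" for k
  proof -
    have "pochhammer t (Suc k) \<noteq> 0" if "pochhammer t N \<noteq> 0" for t :: complex
      using that \<open>k < N\<close> by (metis Suc_leI pochhammer_eq_0_mono)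
    then have "pochhammer (a + b) (Suc k) \<noteq> 0" "pochhammer (a + c) (Suc k) \<noteq> 0"
      "pochhammer (a + d) (Suc k) \<noteq> 0" using nz by auto
    then have z: "pochhammer (a + b) k \<noteq> 0" "pochhammer (a + c) k \<noteq> 0" "pochhammer (a + d) k \<noteq> 0"
      "a + b + of_nat k \<noteq> 0" "a + c + of_nat k \<noteq> 0" "a + d + of_nat k \<noteq> 0"
      by (auto simp: pochhammer_Suc)
    define e :: complex where "e = of_nat k"
    have e1: "1 + e \<noteq> 0"
      using of_nat_neq_0[of k, where 'a=complex] by (simp add: e_def)
    have "C (Suc k) * m k = C k * ((- of_nat N + e) * (of_nat N + a + b + c + d - 1 + e))"
      using z e1 unfolding C_def m_def pochhammer_Suc fact_Suc of_nat_Suc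
      by (simp add: divide_simps flip: e_def)
    also have "(- of_nat N + e) * (of_nat N + a + b + c + d - 1 + e) = wilson_ev s k - wilson_ev s N"
      unfolding wilson_ev_def s_def e_def by (simp add: algebra_simps)
    finally show ?thesis .
  qed
  have "wilson_L a b c d (\<Sum>k\<le>N. Polynomial.smult (C k) (wilson_basis a k)) x =
      (\<Sum>k\<le>N. C k * wilson_L a b c d (wilson_basis a k) x)"
    by (simp add: wilson_L_sum wilson_L_smult)
  also have "\<dots> = (\<Sum>k\<le>N. C k * wilson_ev s k * F k) - (\<Sum>k<N. C (Suc k) * m k * F k)"
  proof -
    have "(\<Sum>k\<le>N. C k * wilson_L a b c d (wilson_basis a k) x) =
        (\<Sum>k<N. C (Suc k) * wilson_L a b c d (wilson_basis a (Suc k)) x)"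
      by (subst sum.atMost_shift) (simp add: wilson_L_basis_0)
    also have "\<dots> = (\<Sum>k<N. C (Suc k) * wilson_ev s (Suc k) * F (Suc k))
        - (\<Sum>k<N. C (Suc k) * m k * F k)"
      by (simp add: wilson_L_basis[OF x] F_def m_def s_def algebra_simps sum_subtractf)
    also have "(\<Sum>k<N. C (Suc k) * wilson_ev s (Suc k) * F (Suc k)) =
        (\<Sum>k\<le>N. C k * wilson_ev s k * F k)"
      by (subst sum.atMost_shift) (simp add: wilson_ev_def)
    finally show ?thesis .
  qed
  also have "(\<Sum>k<N. C (Suc k) * m k * F k) = (\<Sum>k<N. C k * (wilson_ev s k - wilson_ev s N) * F k)"
    by (rule sum.cong) (auto simp: C)
  also have "\<dots> = (\<Sum>k\<le>N. C k * (wilson_ev s k - wilson_ev s N) * F k)"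
    by (simp add: lessThan_Suc_atMost[symmetric])
  finally have "wilson_L a b c d (\<Sum>k\<le>N. Polynomial.smult (C k) (wilson_basis a k)) x =
      wilson_ev s N * (\<Sum>k\<le>N. C k * F k)"
    by (simp add: sum_subtractf[symmetric] sum_distrib_left algebra_simps)
  then show ?thesis
    by (simp add: W wilson_L_smult poly_sum F_def s_def)
qed

section \<open>The Wilson matrix as a linearized difference operator\<close>

text \<open>The monic polynomial with the zeros \<open>(u l)\<^sup>2\<close>, \<open>l \<in> S\<close>.\<close>

definition nodal_poly :: "(nat \<Rightarrow> complex) \<Rightarrow> nat set \<Rightarrow> complex poly" where
  "nodal_poly u S = (\<Prod>l\<in>S. [:- (u l)\<^sup>2, 1:])"

text \<open>
  Minus the derivative at \<open>t = 0\<close> of the nodal polynomial of \<open>u + t v\<close>: the coefficient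
  \<open>2 * u m * v m\<close> is the velocity of the zero \<open>(u m)\<^sup>2\<close>.
\<close>

definition tangent_poly :: "nat \<Rightarrow> (nat \<Rightarrow> complex) \<Rightarrow> (nat \<Rightarrow> complex) \<Rightarrow> complex poly" where
  "tangent_poly N u v =
     (\<Sum>m<N. Polynomial.smult (2 * u m * v m) (nodal_poly u ({..<N} - {m})))"

lemma nodal_poly_remove:
  assumes "finite S" "m \<in> S"
  shows "nodal_poly u S = [:- (u m)\<^sup>2, 1:] * nodal_poly u (S - {m})"
  unfolding nodal_poly_def using assms by (rule prod.remove)

lemma poly_nodal_poly: "poly (nodal_poly u S) z = (\<Prod>l\<in>S. z - (u l)\<^sup>2)"
  by (simp add: nodal_poly_def poly_prod)

lemma poly_nodal_poly_shift:
  assumes "\<And>l. l \<in> S \<Longrightarrow> (u n)\<^sup>2 \<noteq> (u l)\<^sup>2"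
  shows "poly (nodal_poly u S) ((u n - \<i>)\<^sup>2) = poly (nodal_poly u S) ((u n)\<^sup>2) *
    (\<Prod>l\<in>S. 1 - (1 + 2 * \<i> * u n) / ((u n)\<^sup>2 - (u l)\<^sup>2))"
  unfolding poly_nodal_poly prod.distrib[symmetric]
proof (rule prod.cong[OF refl])
  fix l assume "l \<in> S"
  then have "(u n)\<^sup>2 - (u l)\<^sup>2 \<noteq> 0" using assms by simp
  then have "((u n)\<^sup>2 - (u l)\<^sup>2) * (1 - (1 + 2 * \<i> * u n) / ((u n)\<^sup>2 - (u l)\<^sup>2)) =
      ((u n)\<^sup>2 - (u l)\<^sup>2) - (1 + 2 * \<i> * u n)"
    by (simp add: right_diff_distrib)
  also have "\<dots> = (u n - \<i>)\<^sup>2 - (u l)\<^sup>2"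
    by (simp add: power2_eq_square algebra_simps)
  finally show "(u n - \<i>)\<^sup>2 - (u l)\<^sup>2 =
      ((u n)\<^sup>2 - (u l)\<^sup>2) * (1 - (1 + 2 * \<i> * u n) / ((u n)\<^sup>2 - (u l)\<^sup>2))" ..
qed

lemma shift_quotient_linear_mult:
  "shift_quotient ([:- e, 1:] * p) x = poly p ((x - \<i>)\<^sup>2) + (x\<^sup>2 - e) * shift_quotient p x"
  by (subst shift_quotient_mult) simp

lemma shift_quotient_nodal_poly:
  assumes "n < N"
  shows "shift_quotient (nodal_poly u {..<N}) x =
    poly (nodal_poly u ({..<N} - {n})) ((x - \<i>)\<^sup>2)
    + (x\<^sup>2 - (u n)\<^sup>2) * shift_quotient (nodal_poly u ({..<N} - {n})) x"
proof -
  have "nodal_poly u {..<N} = [:- (u n)\<^sup>2, 1:] * nodal_poly u ({..<N} - {n})"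
    using assms by (intro nodal_poly_remove) auto
  then show ?thesis by (simp only: shift_quotient_linear_mult)
qed

lemma DERIV_shift_quotient_nodal_poly:
  fixes u :: "nat \<Rightarrow> complex"
  assumes "n < N"
  shows "(shift_quotient (nodal_poly u {..<N}) has_field_derivative
      (\<Sum>m\<in>{..<N} - {n}. 2 * (u n - \<i>) * poly (nodal_poly u ({..<N} - {n, m})) ((u n - \<i>)\<^sup>2))
      + 2 * u n * shift_quotient (nodal_poly u ({..<N} - {n})) (u n)) (at (u n))"
proof -
  define \<rho> where "\<rho> = nodal_poly u ({..<N} - {n})"
  have "pderiv \<rho> = (\<Sum>m\<in>{..<N} - {n}. nodal_poly u ({..<N} - {n, m}))"
    unfolding \<rho>_def nodal_poly_def pderiv_prod
    by (rule sum.cong) (auto simp: pderiv_pCons Diff_insert2[symmetric] insert_commute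
        intro!: prod.cong)
  then have p': "poly (pderiv \<rho>) ((u n - \<i>)\<^sup>2) * (2 * (u n - \<i>)) =
      (\<Sum>m\<in>{..<N} - {n}. 2 * (u n - \<i>) * poly (nodal_poly u ({..<N} - {n, m})) ((u n - \<i>)\<^sup>2))"
    by (simp add: poly_sum sum_distrib_left mult.commute)
  have 1: "((\<lambda>x. poly \<rho> ((x - \<i>)\<^sup>2)) has_field_derivative
      poly (pderiv \<rho>) ((u n - \<i>)\<^sup>2) * (2 * (u n - \<i>))) (at (u n))"
    by (rule DERIV_chain2[OF poly_DERIV]) (auto intro!: derivative_eq_intros)
  \<comment> \<open>The first factor vanishes at \<open>u n\<close>, so continuity of the second one suffices.\<close>
  have 2: "((\<lambda>x. (x\<^sup>2 - (u n)\<^sup>2) * shift_quotient \<rho> x) has_field_derivative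
      2 * u n * shift_quotient \<rho> (u n)) (at (u n))"
    unfolding CARAT_DERIV
    by (rule exI[of _ "\<lambda>x. (x + u n) * shift_quotient \<rho> x"])
      (auto intro!: continuous_intros isCont_shift_quotient
        simp: algebra_simps power2_eq_square)
  from DERIV_add[OF 1 2] show ?thesis
    unfolding p' unfolding \<rho>_def shift_quotient_nodal_poly[OF assms, abs_def] .
qed

lemma shift_quotient_tangent_poly:
  assumes "n < N"
  shows "shift_quotient (tangent_poly N u v) (u n) =
    2 * u n * v n * shift_quotient (nodal_poly u ({..<N} - {n})) (u n)
    + (\<Sum>m\<in>{..<N} - {n}. 2 * u m * v m * poly (nodal_poly u ({..<N} - {n, m})) ((u n - \<i>)\<^sup>2))"
proof -
  have "shift_quotient (nodal_poly u ({..<N} - {m})) (u n) =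
      poly (nodal_poly u ({..<N} - {n, m})) ((u n - \<i>)\<^sup>2)" if "m \<in> {..<N} - {n}" for m
  proof -
    have "{..<N} - {m} - {n} = {..<N} - {n, m}" by auto
    moreover have "nodal_poly u ({..<N} - {m}) =
        [:- (u n)\<^sup>2, 1:] * nodal_poly u ({..<N} - {m} - {n})"
      using assms that by (intro nodal_poly_remove) auto
    ultimately show ?thesis by (simp only: shift_quotient_linear_mult) simp
  qed
  then show ?thesis
    using assms unfolding tangent_poly_def
    by (subst sum.remove[of _ n])
      (auto simp: shift_quotient_add shift_quotient_sum shift_quotient_smult)
qed

lemma poly_tangent_poly:
  assumes "n < N"
  shows "poly (tangent_poly N u v) ((u n)\<^sup>2) =
    2 * u n * v n * poly (nodal_poly u ({..<N} - {n})) ((u n)\<^sup>2)"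
proof -
  have "poly (nodal_poly u ({..<N} - {m})) ((u n)\<^sup>2) = 0" if "m \<in> {..<N} - {n}" for m
    using assms that by (auto simp: poly_nodal_poly intro!: prod_zero)
  then show ?thesis
    using assms unfolding tangent_poly_def
    by (subst sum.remove[of _ n]) (auto simp: poly_sum)
qed

lemma wilson_A_differentiable:
  "(wilson_A a b c d has_field_derivative deriv (wilson_A a b c d) x) (at x)"
  unfolding DERIV_deriv_iff_field_differentiable wilson_A_def[abs_def] Let_def
  by (intro derivative_intros)

lemma DERIV_wilson_B:
  assumes "x \<noteq> 0"
  shows "(wilson_B a b c d has_field_derivative
    \<i> * (deriv (wilson_A a b c d) x * x - wilson_A a b c d x) / (2 * x\<^sup>2)) (at x)"
  unfolding wilson_B_def[abs_def]
  by (rule derivative_eq_intros wilson_A_differentiable refl)+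
    (use assms in \<open>auto simp: field_simps power2_eq_square\<close>)

text \<open>
  The contribution of one index \<open>m \<noteq> n\<close> to the next lemma, with \<open>u\<close>, \<open>w\<close> for \<open>u n\<close>, \<open>u m\<close> and \<open>r\<close>,
  \<open>r'\<close> for \<open>v n\<close>, \<open>v m\<close>; \<open>P\<close> and \<open>p\<close> stand for the products over the indices other than \<open>n\<close> and
  \<open>m\<close>.
\<close>

lemma jacobian_term:
  fixes A u w r r' P p d :: complex
  assumes u: "u \<noteq> 0" and d: "d \<noteq> 0" "d = u\<^sup>2 - w\<^sup>2"
  shows "(\<i> * A / (2 * u)) * (2 * (u - \<i>) * r - 2 * w * r') * (P * p) =
    2 * u * (P * d) *
      (1 / (2 * u)\<^sup>2 * (2 * A * ((\<i> * u - (u\<^sup>2 + w\<^sup>2)) / d\<^sup>2 * p)) * r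
       + - (1 / (2 * u)\<^sup>2) * (2 * A) * (\<i> * w * (1 + 2 * \<i> * u) / d\<^sup>2) * p * r')
    + (\<i> * A / (2 * u)) * (P * d * (p * (1 - (1 + 2 * \<i> * u) / d)))
      * ((2 * u * r - 2 * w * r') / d)" (is "_ = ?rhs")
proof -
  have "(\<i> * A / (2 * u)) * (2 * (u - \<i>) * r - 2 * w * r') * (P * p) =
      A * P * p / (u * d) * (\<i> * ((u - \<i>) * r - w * r') * d)"
    using u d(1) by (simp add: field_simps)
  also have "\<i> * ((u - \<i>) * r - w * r') * d =
      (\<i> * u - (u\<^sup>2 + w\<^sup>2)) * r - \<i> * w * (1 + 2 * \<i> * u) * r'
      + \<i> * (d - (1 + 2 * \<i> * u)) * (u * r - w * r')"
    unfolding d(2) by (simp add: algebra_simps power2_eq_square)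
  also have "A * P * p / (u * d) * \<dots> = ?rhs"
    using u d(1) by (simp add: divide_simps) (simp add: algebra_simps power2_eq_square)
  finally show ?thesis .
qed

text \<open>
  Write \<open>f\<close> for the half \<open>x \<mapsto> wilson_B x * shift_quotient \<psi> x\<close> of the operator applied to the nodal
  polynomial \<open>\<psi>\<close>. The left-hand side is the derivative of \<open>f (u n)\<close> when all \<open>u m\<close>, and \<open>\<psi>\<close> with
  them, move with velocities \<open>v m\<close>: \<open>v n * E\<close> comes from the argument and the other term from \<open>\<psi>\<close>.
  On the other hand \<open>f (u n) = 2 u n \<psi>'((u n)\<^sup>2) g\<close>, where \<open>g\<close> has the row \<open>wilson_Phi N a b c d u n\<close>
  as its gradient. The right-hand side is the product rule for this factorization, and the bracket in
  its last summand is the logarithmic derivative of \<open>u n \<psi>'((u n)\<^sup>2)\<close>.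
\<close>

lemma wilson_Phi_apply:
  fixes u v :: "nat \<Rightarrow> complex"
  assumes n: "n < N" and u0: "u n \<noteq> 0"
    and dist: "\<And>l. l < N \<Longrightarrow> l \<noteq> n \<Longrightarrow> (u n)\<^sup>2 \<noteq> (u l)\<^sup>2"
  defines "\<psi> \<equiv> nodal_poly u {..<N}"
  shows "\<exists>E. ((\<lambda>x. wilson_B a b c d x * shift_quotient \<psi> x) has_field_derivative E) (at (u n)) \<and>
    v n * E - wilson_B a b c d (u n) * shift_quotient (tangent_poly N u v) (u n) =
      2 * u n * poly (nodal_poly u ({..<N} - {n})) ((u n)\<^sup>2) *
        (\<Sum>m<N. wilson_Phi N a b c d u n m * v m)
      + wilson_B a b c d (u n) * shift_quotient \<psi> (u n) *
        (v n / u n + (\<Sum>m\<in>{..<N} - {n}. (2 * u n * v n - 2 * u m * v m) / ((u n)\<^sup>2 - (u m)\<^sup>2)))"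
proof -
  define J where "J = {..<N} - {n}"
  define A where "A = wilson_A a b c d (u n)"
  define A' where "A' = deriv (wilson_A a b c d) (u n)"
  define B where "B = wilson_B a b c d (u n)"
  define B' where "B' = \<i> * (A' * u n - A) / (2 * (u n)\<^sup>2)"
  define D where "D m = (u n)\<^sup>2 - (u m)\<^sup>2" for m
  define P where "P = poly (nodal_poly u ({..<N} - {n})) ((u n)\<^sup>2)"
  define Pm where "Pm m = poly (nodal_poly u ({..<N} - {n, m})) ((u n)\<^sup>2)" for m
  define p where "p = wilson_prod N u n {n}"
  define pm where "pm m = wilson_prod N u n {n, m}" for m
  define Qm where "Qm m = poly (nodal_poly u ({..<N} - {n, m})) ((u n - \<i>)\<^sup>2)" for m
  define S where "S = shift_quotient (nodal_poly u ({..<N} - {n})) (u n)"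
  define F where "F m = 1 / (2 * u n)\<^sup>2 *
    (2 * A * ((\<i> * u n - ((u n)\<^sup>2 + (u m)\<^sup>2)) / (D m)\<^sup>2 * pm m))" for m
  define G where "G m = - (1 / (2 * u n)\<^sup>2) * (2 * A) *
    (\<i> * u m * (1 + 2 * \<i> * u n) / (D m)\<^sup>2) * pm m" for m
  have Q0: "shift_quotient \<psi> (u n) = P * p"
    unfolding \<psi>_def shift_quotient_nodal_poly[OF n]
    using poly_nodal_poly_shift[of "{..<N} - {n}" u n] dist
    by (simp add: P_def p_def wilson_prod_def)
  have Qm: "Qm m = Pm m * pm m" for m
    using poly_nodal_poly_shift[of "{..<N} - {n, m}" u n] dist
    by (simp add: Qm_def Pm_def pm_def wilson_prod_def)
  have D0: "D m \<noteq> 0" if "m \<in> J" for m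
    using dist[of m] that by (simp add: D_def J_def)
  have rem: "{..<N} - {n} = insert m ({..<N} - {n, m})" if "m \<in> J" for m
    using that by (auto simp: J_def)
  have PD: "P = Pm m * D m" if "m \<in> J" for m
    unfolding P_def Pm_def poly_nodal_poly rem[OF that] D_def by (simp add: mult.commute)
  have pD: "p = pm m * (1 - (1 + 2 * \<i> * u n) / D m)" if "m \<in> J" for m
    unfolding p_def pm_def wilson_prod_def rem[OF that] D_def by (simp add: mult.commute)
  have B: "B = \<i> * A / (2 * u n)"
    by (simp add: B_def A_def wilson_B_def)
  define E where "E = B' * (P * p) + ((\<Sum>m\<in>J. 2 * (u n - \<i>) * Qm m) + 2 * u n * S) * B"
  have "((\<lambda>x. wilson_B a b c d x * shift_quotient \<psi> x) has_field_derivative E) (at (u n))"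
    using DERIV_mult[OF DERIV_wilson_B[OF u0, of a b c d] DERIV_shift_quotient_nodal_poly[OF n, of u]]
    unfolding E_def B'_def B_def Q0[symmetric] S_def Qm_def A_def A'_def J_def \<psi>_def .
  moreover have "v n * E - B * shift_quotient (tangent_poly N u v) (u n) =
      2 * u n * P * (\<Sum>m<N. wilson_Phi N a b c d u n m * v m)
      + B * (P * p) * (v n / u n + (\<Sum>m\<in>J. (2 * u n * v n - 2 * u m * v m) / D m))"
  proof -
    have offdiag: "B * (2 * (u n - \<i>) * v n - 2 * u m * v m) * Qm m =
        2 * u n * P * (F m * v n + G m * v m)
        + B * (P * p) * ((2 * u n * v n - 2 * u m * v m) / D m)" if "m \<in> J" for m
      unfolding Qm B F_def G_def
      using jacobian_term[OF u0 D0[OF that] D_def, of A "v n" "v m" "Pm m" "pm m"]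
      by (simp only: PD[OF that] pD[OF that])
    define H where "H = 1 / (2 * u n)\<^sup>2 * ((2 * A / (\<i> * u n) + \<i> * A') * p)"
    have diag: "v n * (B' * (P * p)) = 2 * u n * P * (H * v n) + B * (P * p) * (v n / u n)"
      unfolding H_def B'_def B using u0 by (simp add: field_simps power2_eq_square)
    have "(\<Sum>m<N. wilson_Phi N a b c d u n m * v m) =
        wilson_Phi N a b c d u n n * v n + (\<Sum>m\<in>J. wilson_Phi N a b c d u n m * v m)"
      using n unfolding J_def by (intro sum.remove) auto
    also have "wilson_Phi N a b c d u n n = H + (\<Sum>m\<in>J. F m)"
      unfolding wilson_Phi_def Let_def H_def F_def
      by (simp add: A_def A'_def p_def pm_def D_def J_def sum_distrib_left distrib_left)
    also have "(\<Sum>m\<in>J. wilson_Phi N a b c d u n m * v m) = (\<Sum>m\<in>J. G m * v m)"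
      by (rule sum.cong) (auto simp: wilson_Phi_def Let_def G_def A_def pm_def D_def J_def)
    finally have Phi: "(\<Sum>m<N. wilson_Phi N a b c d u n m * v m) =
        H * v n + (\<Sum>m\<in>J. F m * v n + G m * v m)"
      by (simp add: sum.distrib sum_distrib_right distrib_right)
    have "v n * E - B * shift_quotient (tangent_poly N u v) (u n) =
        v n * (B' * (P * p)) + (\<Sum>m\<in>J. B * (2 * (u n - \<i>) * v n - 2 * u m * v m) * Qm m)"
      unfolding E_def shift_quotient_tangent_poly[OF n] S_def[symmetric] Qm_def[symmetric]
      unfolding J_def[symmetric]
      by (simp add: algebra_simps sum.distrib sum_subtractf sum_distrib_left)
    also have "\<dots> = 2 * u n * P * (H * v n) + B * (P * p) * (v n / u n) +
        (\<Sum>m\<in>J. 2 * u n * P * (F m * v n + G m * v m)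
        + B * (P * p) * ((2 * u n * v n - 2 * u m * v m) / D m))"
      unfolding diag
      by (rule arg_cong2[where f = "(+)"], rule refl, rule sum.cong[OF refl], rule offdiag)
    also have "\<dots> = 2 * u n * P * (\<Sum>m<N. wilson_Phi N a b c d u n m * v m)
      + B * (P * p) * (v n / u n + (\<Sum>m\<in>J. (2 * u n * v n - 2 * u m * v m) / D m))"
      unfolding Phi by (simp only: sum.distrib sum_distrib_left distrib_left ac_simps)
    finally show ?thesis .
  qed
  ultimately show ?thesis
    unfolding B_def P_def J_def D_def Q0 by blast
qed

lemma nodal_poly_uminus: "nodal_poly (\<lambda>s. - u s) S = nodal_poly u S"
  by (simp add: nodal_poly_def)

lemma tangent_poly_uminus: "tangent_poly N (\<lambda>s. - u s) (\<lambda>s. - v s) = tangent_poly N u v"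
  by (simp add: tangent_poly_def nodal_poly_uminus)

text \<open>
  If \<open>\<psi>\<close> is an eigenfunction of the operator with eigenvalue \<open>\<mu>\<close>, then an eigenvector of the
  Wilson matrix for \<open>k\<close> gives a polynomial that satisfies the eigenvalue equation for \<open>\<mu> - k\<close> at the
  nodes. The hypothesis on \<open>v\<close> is the \<open>n\<close>-th row of the eigenvector equation.
\<close>

lemma wilson_L_tangent_poly:
  fixes x v :: "nat \<Rightarrow> complex"
  assumes n: "n < N" and x0: "x n \<noteq> 0"
    and dist: "\<And>l. l < N \<Longrightarrow> l \<noteq> n \<Longrightarrow> (x n)\<^sup>2 \<noteq> (x l)\<^sup>2"
    and eigen: "\<And>t. t \<noteq> 0 \<Longrightarrow> wilson_L a b c d (nodal_poly x {..<N}) t =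
      \<mu> * poly (nodal_poly x {..<N}) (t\<^sup>2)"
    and Mv: "(\<Sum>m<N. (wilson_Phi N a b c d x n m + wilson_Phi N a b c d (\<lambda>s. - x s) n m) * v m) =
      k * v n"
  shows "wilson_L a b c d (tangent_poly N x v) (x n) =
    (\<mu> - k) * poly (tangent_poly N x v) ((x n)\<^sup>2)"
proof -
  define \<psi> where "\<psi> = nodal_poly x {..<N}"
  define P where "P = poly (nodal_poly x ({..<N} - {n})) ((x n)\<^sup>2)"
  define q where "q = tangent_poly N x v"
  define R where "R = v n / x n +
    (\<Sum>m\<in>{..<N} - {n}. (2 * x n * v n - 2 * x m * v m) / ((x n)\<^sup>2 - (x m)\<^sup>2))"
  define f where "f t = wilson_B a b c d t * shift_quotient \<psi> t" for t
  obtain E where E: "(f has_field_derivative E) (at (x n))"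
    "v n * E - wilson_B a b c d (x n) * shift_quotient q (x n) =
      2 * x n * P * (\<Sum>m<N. wilson_Phi N a b c d x n m * v m) + f (x n) * R"
    using wilson_Phi_apply[of n N x a b c d v] n x0 dist
    unfolding f_def[abs_def] \<psi>_def P_def q_def R_def by blast
  obtain E' where E': "(f has_field_derivative E') (at (- x n))"
    "- v n * E' - wilson_B a b c d (- x n) * shift_quotient q (- x n) =
      - 2 * x n * P * (\<Sum>m<N. wilson_Phi N a b c d (\<lambda>s. - x s) n m * - v m) + f (- x n) * R"
    using wilson_Phi_apply[of n N "\<lambda>s. - x s" a b c d "\<lambda>s. - v s"] n x0 dist
    unfolding f_def[abs_def] \<psi>_def P_def q_def R_def nodal_poly_uminus tangent_poly_uminus
    by auto
  have L\<psi>: "wilson_L a b c d \<psi> t = f t + f (- t)" for t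
    by (simp add: wilson_L_def f_def)
  have \<psi>: "\<psi> = [:- (x n)\<^sup>2, 1:] * nodal_poly x ({..<N} - {n})"
    unfolding \<psi>_def using n by (intro nodal_poly_remove) auto
  \<comment> \<open>The logarithmic derivative \<open>R\<close> is the same for the nodes \<open>x\<close> and \<open>- x\<close>, so it drops out of the
     sum of the two halves.\<close>
  have zero: "f (x n) + f (- x n) = 0"
    using eigen[OF x0] unfolding \<psi>_def[symmetric] L\<psi> by (simp add: \<psi>)
  have "((\<lambda>t. f (- t)) has_field_derivative E' * - 1) (at (x n))"
    by (rule DERIV_chain2[where f = f and g = uminus, OF E'(1)]) (auto intro!: derivative_eq_intros)
  then have 1: "((\<lambda>t. f t + f (- t)) has_field_derivative E - E') (at (x n))"
    using DERIV_add[OF E(1)] by fastforce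
  have "((\<lambda>t. \<mu> * poly \<psi> (t\<^sup>2)) has_field_derivative \<mu> * (poly (pderiv \<psi>) ((x n)\<^sup>2) * (2 * x n)))
      (at (x n))"
    by (intro DERIV_cmult DERIV_chain2[OF poly_DERIV]) (auto intro!: derivative_eq_intros)
  then have "((\<lambda>t. f t + f (- t)) has_field_derivative
      \<mu> * (poly (pderiv \<psi>) ((x n)\<^sup>2) * (2 * x n))) (at (x n))"
    by (rule has_field_derivative_transform_within_open[where S = "- {0}"])
      (use x0 eigen in \<open>auto simp: L\<psi> simp flip: \<psi>_def\<close>)
  then have EE: "E - E' = \<mu> * (poly (pderiv \<psi>) ((x n)\<^sup>2) * (2 * x n))"
    using DERIV_unique 1 by blast
  have "poly (pderiv \<psi>) ((x n)\<^sup>2) = P"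
    unfolding \<psi> pderiv_mult by (simp add: P_def pderiv_pCons)
  then have "v n * (E - E') = \<mu> * (2 * x n * v n * P)"
    unfolding EE by simp
  moreover have "v n * (E - E') - wilson_L a b c d q (x n) =
      2 * x n * P * (k * v n) + (f (x n) + f (- x n)) * R"
    using E(2) E'(2) unfolding Mv[symmetric]
    by (simp add: wilson_L_def algebra_simps sum.distrib sum_negf)
  moreover have "poly q ((x n)\<^sup>2) = 2 * x n * v n * P"
    unfolding q_def P_def by (rule poly_tangent_poly[OF n])
  ultimately show ?thesis
    unfolding zero q_def by (simp add: algebra_simps)
qed

section \<open>Eigenvalues of the Wilson matrix\<close>

lemma nodal_poly_monic: "Polynomial.lead_coeff (nodal_poly u S) = 1"
  by (simp add: nodal_poly_def lead_coeff_prod)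

lemma degree_nodal_poly:
  assumes "finite S"
  shows "Polynomial.degree (nodal_poly u S) = card S"
  using assms unfolding nodal_poly_def by (subst degree_prod_eq_sum_degree) auto

lemma poly_eq_nodal_poly:
  fixes p :: "complex poly"
  assumes inj: "inj_on (\<lambda>s. (x s)\<^sup>2) {..<N}" and deg: "Polynomial.degree p = N"
    and root: "\<And>n. n < N \<Longrightarrow> poly p ((x n)\<^sup>2) = 0"
  shows "p = Polynomial.smult (Polynomial.lead_coeff p) (nodal_poly x {..<N})"
proof (rule poly_eqI_degree_lead_coeff)
  have dn: "Polynomial.degree (nodal_poly x {..<N}) = N"
    by (simp add: degree_nodal_poly)
  then show "Polynomial.coeff p N =
      Polynomial.coeff (Polynomial.smult (Polynomial.lead_coeff p) (nodal_poly x {..<N})) N"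
    using nodal_poly_monic[of x "{..<N}"] deg by simp
  show "N \<le> card ((\<lambda>s. (x s)\<^sup>2) ` {..<N})"
    using inj by (simp add: card_image)
  show "Polynomial.degree p \<le> N"
    "Polynomial.degree (Polynomial.smult (Polynomial.lead_coeff p) (nodal_poly x {..<N})) \<le> N"
    using deg dn by simp_all
  show "poly p z = poly (Polynomial.smult (Polynomial.lead_coeff p) (nodal_poly x {..<N})) z"
    if "z \<in> (\<lambda>s. (x s)\<^sup>2) ` {..<N}" for z
    using that root by (auto simp: poly_nodal_poly intro!: prod_zero)
qed

lemma wilson_matrix_eigenvalue:
  assumes adm: "wilson_admissible N a b c d" and nodes: "wilson_nodes N a b c d x"
    and ev: "eigenvalue (wilson_matrix N a b c d x) k"
  shows "\<exists>j<N. k = wilson_ev (a + b + c + d) N - wilson_ev (a + b + c + d) j"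
proof -
  define W where "W = wilson_poly N a b c d"
  define s where "s = a + b + c + d"
  define \<psi> where "\<psi> = nodal_poly x {..<N}"
  have inj: "inj_on (\<lambda>s. (x s)\<^sup>2) {..<N}"
    using nodes by (simp add: wilson_nodes_def bij_betw_def)
  have root: "poly W ((x n)\<^sup>2) = 0" if "n < N" for n
    using nodes that unfolding wilson_nodes_def W_def by (auto dest: bij_betwE)
  have W0: "poly W 0 \<noteq> 0" and degW: "Polynomial.degree W = N"
    and nz: "pochhammer (a + b) N * pochhammer (a + c) N * pochhammer (a + d) N \<noteq> 0"
    using adm unfolding wilson_admissible_def W_def by blast+
  have x0: "x n \<noteq> 0" if "n < N" for n
    using root[OF that] W0 by auto
  have dist: "(x n)\<^sup>2 \<noteq> (x l)\<^sup>2" if "n < N" "l < N" "l \<noteq> n" for n l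
    using inj_onD[OF inj, of n l] that by auto
  have W: "W = Polynomial.smult (Polynomial.lead_coeff W) \<psi>"
    unfolding \<psi>_def using inj degW root by (rule poly_eq_nodal_poly)
  have lc: "Polynomial.lead_coeff W \<noteq> 0" using W0 by auto
  have eigen: "wilson_L a b c d \<psi> t = wilson_ev s N * poly \<psi> (t\<^sup>2)" if "t \<noteq> 0" for t
  proof -
    have "wilson_L a b c d W t = wilson_ev s N * poly W (t\<^sup>2)"
      using wilson_L_wilson_poly[OF nz that] by (simp add: W_def s_def)
    then have "Polynomial.lead_coeff W * wilson_L a b c d \<psi> t =
        Polynomial.lead_coeff W * (wilson_ev s N * poly \<psi> (t\<^sup>2))"
      by (subst (asm) (1 2) W) (simp add: wilson_L_smult)
    with lc show ?thesis by simp
  qed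
  obtain w where w: "w \<in> carrier_vec N" "w \<noteq> 0\<^sub>v N"
    "wilson_matrix N a b c d x *\<^sub>v w = k \<cdot>\<^sub>v w"
    using ev unfolding eigenvalue_def eigenvector_def by (auto simp: wilson_matrix_def)
  define v where "v m = w $ m" for m
  have Mv: "(\<Sum>m<N. (wilson_Phi N a b c d x n m + wilson_Phi N a b c d (\<lambda>s. - x s) n m) * v m) =
      k * v n" if "n < N" for n
  proof -
    have "(wilson_matrix N a b c d x *\<^sub>v w) $ n = (k \<cdot>\<^sub>v w) $ n"
      by (simp add: w(3))
    then show ?thesis
      using that w(1)
      by (simp add: wilson_matrix_def scalar_prod_def v_def lessThan_atLeast0)
  qed
  define q where "q = tangent_poly N x v"
  have Lq: "wilson_L a b c d q (x n) = (wilson_ev s N - k) * poly q ((x n)\<^sup>2)" if "n < N" for n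
    unfolding q_def
    using that x0 dist eigen Mv by (intro wilson_L_tangent_poly) (auto simp: \<psi>_def)
  obtain m where m: "m < N" "v m \<noteq> 0"
  proof -
    have "\<exists>m<N. v m \<noteq> 0"
    proof (rule ccontr)
      assume "\<not> ?thesis"
      then have "w = 0\<^sub>v N" using w(1) by (intro eq_vecI) (auto simp: v_def)
      with w(2) show False by simp
    qed
    then show ?thesis using that by blast
  qed
  have "poly q ((x m)\<^sup>2) \<noteq> 0"
    unfolding q_def poly_tangent_poly[OF m(1)]
    using m x0 dist by (auto simp: poly_nodal_poly)
  then have q0: "q \<noteq> 0" by auto
  define j where "j = Polynomial.degree q"
  have "Polynomial.degree q \<le> N - 1"
    unfolding q_def tangent_poly_def
    by (intro degree_sum_le order.trans[OF degree_smult_le])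
      (auto simp: degree_nodal_poly)
  then have j: "j < N" using m(1) by (simp add: j_def)
  obtain r where r: "\<And>i. i \<ge> j \<Longrightarrow> Polynomial.coeff r i = 0"
    "\<And>t. t \<noteq> 0 \<Longrightarrow> wilson_L a b c d q t =
       poly (Polynomial.smult (wilson_ev s j) q + r) (t\<^sup>2)"
    using wilson_L_triangular[of q j a b c d] unfolding j_def s_def by blast
  \<comment> \<open>\<open>q\<close> has degree less than \<open>N\<close>, so its eigenvalue equation at the \<open>N\<close> nodes is an identity of
     polynomials, whose coefficient at \<open>j\<close> determines \<open>k\<close>.\<close>
  define g where "g = Polynomial.smult (wilson_ev s N - k - wilson_ev s j) q - r"
  have "g = 0"
  proof (rule poly_eqI_degree)
    have card: "card ((\<lambda>s. (x s)\<^sup>2) ` {..<N}) = N"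
      using inj by (simp add: card_image)
    show "poly g z = poly 0 z" if "z \<in> (\<lambda>s. (x s)\<^sup>2) ` {..<N}" for z
      using that Lq r(2) x0 by (auto simp: g_def algebra_simps)
    have "Polynomial.degree g \<le> j"
      using r(1) by (intro degree_le) (auto simp: g_def j_def coeff_eq_0)
    then show "Polynomial.degree g < card ((\<lambda>s. (x s)\<^sup>2) ` {..<N})"
      "Polynomial.degree (0 :: complex poly) < card ((\<lambda>s. (x s)\<^sup>2) ` {..<N})"
      using j card by simp_all
  qed
  then have "Polynomial.coeff g j = 0" by simp
  then have "wilson_ev s N - k - wilson_ev s j = 0"
    using r(1)[of j] q0 by (simp add: g_def j_def)
  then show ?thesis using j unfolding s_def by (intro exI[of _ j]) (auto simp: algebra_simps)
qed

section \<open>Racah matrices as Wilson matrices\<close>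

text \<open>
  Together with \<open>racah_theta \<gamma> \<delta>\<close> as \<open>a\<close>, these are the Wilson parameters \<open>b\<close>, \<open>c\<close>, \<open>d\<close> that
  correspond to the Racah parameters under \<open>x = - \<i> y\<close>. The factors of the numerator of \<open>racah_D\<close> are
  then \<open>2 (a + y)\<close>, \<open>2 (b + y)\<close>, \<open>2 (c + y)\<close> and \<open>2 (d + y)\<close>.
\<close>

definition racah_b :: "complex \<Rightarrow> complex \<Rightarrow> complex" where "racah_b \<gamma> \<delta> = (\<gamma> - \<delta> + 1) / 2"
definition racah_c :: "complex \<Rightarrow> complex \<Rightarrow> complex \<Rightarrow> complex" where
  "racah_c \<alpha> \<gamma> \<delta> = \<alpha> + (1 - \<gamma> - \<delta>) / 2"
definition racah_d :: "complex \<Rightarrow> complex \<Rightarrow> complex \<Rightarrow> complex" where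
  "racah_d \<beta> \<gamma> \<delta> = \<beta> + (1 - \<gamma> + \<delta>) / 2"

lemma racah_params:
  "racah_theta \<gamma> \<delta> + racah_b \<gamma> \<delta> = \<gamma> + 1"
  "racah_theta \<gamma> \<delta> + racah_c \<alpha> \<gamma> \<delta> = \<alpha> + 1"
  "racah_theta \<gamma> \<delta> + racah_d \<beta> \<gamma> \<delta> = \<beta> + \<delta> + 1"
  "racah_theta \<gamma> \<delta> + racah_b \<gamma> \<delta> + racah_c \<alpha> \<gamma> \<delta> + racah_d \<beta> \<gamma> \<delta> = \<alpha> + \<beta> + 2"
  by (simp_all add: racah_theta_def racah_b_def racah_c_def racah_d_def field_simps)

abbreviation racah_wilson_A :: "complex \<Rightarrow> complex \<Rightarrow> complex \<Rightarrow> complex \<Rightarrow> complex \<Rightarrow> complex" where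
  "racah_wilson_A \<alpha> \<beta> \<gamma> \<delta> \<equiv>
     wilson_A (racah_theta \<gamma> \<delta>) (racah_b \<gamma> \<delta>) (racah_c \<alpha> \<gamma> \<delta>) (racah_d \<beta> \<gamma> \<delta>)"

abbreviation racah_wilson_poly ::
  "nat \<Rightarrow> complex \<Rightarrow> complex \<Rightarrow> complex \<Rightarrow> complex \<Rightarrow> complex poly" where
  "racah_wilson_poly N \<alpha> \<beta> \<gamma> \<delta> \<equiv>
     wilson_poly N (racah_theta \<gamma> \<delta>) (racah_b \<gamma> \<delta>) (racah_c \<alpha> \<gamma> \<delta>) (racah_d \<beta> \<gamma> \<delta>)"

text \<open>The point \<open>z = y\<^sup>2 - \<theta>\<^sup>2\<close> in the Racah variable becomes \<open>- y\<^sup>2\<close> in the Wilson variable.\<close>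

lemma poly_racah_wilson:
  "poly (racah_wilson_poly N \<alpha> \<beta> \<gamma> \<delta>) (- z - (racah_theta \<gamma> \<delta>)\<^sup>2) =
    pochhammer (\<gamma> + 1) N * pochhammer (\<alpha> + 1) N * pochhammer (\<beta> + \<delta> + 1) N *
    poly (racah_poly N \<alpha> \<beta> \<gamma> \<delta>) z"
proof -
  have 1: "(racah_theta \<gamma> \<delta> + of_nat j)\<^sup>2 + (- z - (racah_theta \<gamma> \<delta>)\<^sup>2) =
      of_nat j * (\<gamma> + \<delta> + 1) + (of_nat j)\<^sup>2 - z" for j
    by (simp add: racah_theta_def power2_eq_square field_simps)
  have 2: "poly (wilson_basis (racah_theta \<gamma> \<delta>) k) (- z - (racah_theta \<gamma> \<delta>)\<^sup>2) =
      poly (racah_basis \<gamma> \<delta> k) z" for k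
    unfolding wilson_basis_def racah_basis_def poly_prod
    by (rule prod.cong[OF refl]) (use 1 in \<open>simp add: algebra_simps\<close>)
  have s: "of_nat N + racah_theta \<gamma> \<delta> + racah_b \<gamma> \<delta> + racah_c \<alpha> \<gamma> \<delta> + racah_d \<beta> \<gamma> \<delta> - 1 =
      of_nat N + \<alpha> + \<beta> + 1"
    using racah_params(4)[of \<gamma> \<delta> \<alpha> \<beta>] by (simp add: algebra_simps)
  show ?thesis
    unfolding wilson_poly_def racah_poly_def s racah_params poly_smult poly_sum 2
    by (simp add: ac_simps)
qed

lemma racah_wilson_roots:
  assumes "pochhammer (\<alpha> + 1) N * pochhammer (\<beta> + \<delta> + 1) N * pochhammer (\<gamma> + 1) N \<noteq> 0"
  shows "bij_betw (\<lambda>z. - z - (racah_theta \<gamma> \<delta>)\<^sup>2) {z. poly (racah_poly N \<alpha> \<beta> \<gamma> \<delta>) z = 0}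
    {z. poly (racah_wilson_poly N \<alpha> \<beta> \<gamma> \<delta>) z = 0}"
proof (rule bij_betw_byWitness[where f' = "\<lambda>z. - z - (racah_theta \<gamma> \<delta>)\<^sup>2"])
  have "poly (racah_poly N \<alpha> \<beta> \<gamma> \<delta>) (- z - (racah_theta \<gamma> \<delta>)\<^sup>2) = 0"
    if "poly (racah_wilson_poly N \<alpha> \<beta> \<gamma> \<delta>) z = 0" for z
    using poly_racah_wilson[of N \<gamma> \<delta> \<alpha> \<beta> "- z - (racah_theta \<gamma> \<delta>)\<^sup>2"] that assms by auto
  then show "(\<lambda>z. - z - (racah_theta \<gamma> \<delta>)\<^sup>2) ` {z. poly (racah_wilson_poly N \<alpha> \<beta> \<gamma> \<delta>) z = 0}
      \<subseteq> {z. poly (racah_poly N \<alpha> \<beta> \<gamma> \<delta>) z = 0}"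
    by auto
qed (auto simp: poly_racah_wilson)

lemma degree_racah_wilson:
  assumes "pochhammer (\<alpha> + 1) N * pochhammer (\<beta> + \<delta> + 1) N * pochhammer (\<gamma> + 1) N \<noteq> 0"
  shows "Polynomial.degree (racah_wilson_poly N \<alpha> \<beta> \<gamma> \<delta>) =
    Polynomial.degree (racah_poly N \<alpha> \<beta> \<gamma> \<delta>)"
proof -
  have "racah_wilson_poly N \<alpha> \<beta> \<gamma> \<delta> \<circ>\<^sub>p [:- (racah_theta \<gamma> \<delta>)\<^sup>2, - 1:] =
      Polynomial.smult (pochhammer (\<gamma> + 1) N * pochhammer (\<alpha> + 1) N * pochhammer (\<beta> + \<delta> + 1) N)
        (racah_poly N \<alpha> \<beta> \<gamma> \<delta>)"
    using poly_racah_wilson[of N \<gamma> \<delta> \<alpha> \<beta>]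
    by (subst poly_eq_poly_eq_iff[symmetric]) (simp add: fun_eq_iff poly_pcompose algebra_simps)
  from arg_cong[OF this, of Polynomial.degree] show ?thesis
    using assms by (simp add: degree_pcompose)
qed

lemma racah_admissible_imp_wilson:
  assumes "racah_admissible N \<alpha> \<beta> \<gamma> \<delta>"
  shows "wilson_admissible N (racah_theta \<gamma> \<delta>) (racah_b \<gamma> \<delta>) (racah_c \<alpha> \<gamma> \<delta>) (racah_d \<beta> \<gamma> \<delta>)"
proof -
  have nz: "pochhammer (\<alpha> + 1) N * pochhammer (\<beta> + \<delta> + 1) N * pochhammer (\<gamma> + 1) N \<noteq> 0"
    using assms unfolding racah_admissible_def by blast
  have "poly (racah_poly N \<alpha> \<beta> \<gamma> \<delta>) (0\<^sup>2 - (racah_theta \<gamma> \<delta>)\<^sup>2) \<noteq> 0"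
    using assms unfolding racah_admissible_def by blast
  then have "poly (racah_wilson_poly N \<alpha> \<beta> \<gamma> \<delta>) 0 \<noteq> 0"
    using poly_racah_wilson[of N \<gamma> \<delta> \<alpha> \<beta> "- (racah_theta \<gamma> \<delta>)\<^sup>2"] nz by simp
  then show ?thesis
    using assms nz bij_betw_same_card[OF racah_wilson_roots[OF nz]] degree_racah_wilson[OF nz]
    unfolding wilson_admissible_def racah_admissible_def racah_params by simp
qed

lemma racah_nodes_imp_wilson:
  assumes "racah_admissible N \<alpha> \<beta> \<gamma> \<delta>" "racah_nodes N \<alpha> \<beta> \<gamma> \<delta> y"
  shows "wilson_nodes N (racah_theta \<gamma> \<delta>) (racah_b \<gamma> \<delta>) (racah_c \<alpha> \<gamma> \<delta>) (racah_d \<beta> \<gamma> \<delta>)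
    (\<lambda>s. - \<i> * y s)"
proof -
  have nz: "pochhammer (\<alpha> + 1) N * pochhammer (\<beta> + \<delta> + 1) N * pochhammer (\<gamma> + 1) N \<noteq> 0"
    using assms unfolding racah_admissible_def by blast
  have "(\<lambda>s. (- \<i> * y s)\<^sup>2) =
      (\<lambda>z. - z - (racah_theta \<gamma> \<delta>)\<^sup>2) \<circ> (\<lambda>s. (y s)\<^sup>2 - (racah_theta \<gamma> \<delta>)\<^sup>2)"
    by (auto simp: power_mult_distrib)
  then show ?thesis
    using bij_betw_trans[OF _ racah_wilson_roots[OF nz]] assms(2)
    unfolding wilson_nodes_def racah_nodes_def by metis
qed

lemma racah_D_eq:
  "racah_D \<alpha> \<beta> \<gamma> \<delta> y = racah_wilson_A \<alpha> \<beta> \<gamma> \<delta> (- \<i> * y) / (2 * y * (2 * y + 1))"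
proof -
  have "(2 * y + \<gamma> + \<delta> + 1) * (2 * y + \<gamma> - \<delta> + 1) *
     (2 * y + 2 * \<alpha> - \<gamma> - \<delta> + 1) * (2 * y + 2 * \<beta> - \<gamma> + \<delta> + 1) =
     (2 * (racah_theta \<gamma> \<delta> + y)) * (2 * (racah_b \<gamma> \<delta> + y)) *
     (2 * (racah_c \<alpha> \<gamma> \<delta> + y)) * (2 * (racah_d \<beta> \<gamma> \<delta> + y))"
    by (rule arg_cong2[where f = "(*)"])+
      (simp_all add: racah_theta_def racah_b_def racah_c_def racah_d_def field_simps)
  also have "\<dots> = 16 * racah_wilson_A \<alpha> \<beta> \<gamma> \<delta> (- \<i> * y)"
  proof -
    have A: "racah_wilson_A \<alpha> \<beta> \<gamma> \<delta> (- \<i> * y) = (racah_theta \<gamma> \<delta> + y) * (racah_b \<gamma> \<delta> + y) *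
        (racah_c \<alpha> \<gamma> \<delta> + y) * (racah_d \<beta> \<gamma> \<delta> + y)"
      by (simp add: wilson_A_prod)
    have "(2 * p) * (2 * q) * (2 * r) * (2 * s) = 16 * (p * q * r * s)" for p q r s :: complex
      by simp
    then show ?thesis unfolding A .
  qed
  finally show ?thesis by (simp add: racah_D_def)
qed

lemma deriv_racah_D:
  assumes "y \<noteq> 0" "2 * y + 1 \<noteq> 0"
  shows "deriv (racah_D \<alpha> \<beta> \<gamma> \<delta>) y =
    (- \<i> * deriv (racah_wilson_A \<alpha> \<beta> \<gamma> \<delta>) (- \<i> * y) * (2 * y * (2 * y + 1))
      - racah_wilson_A \<alpha> \<beta> \<gamma> \<delta> (- \<i> * y) * (8 * y + 2)) / (2 * y * (2 * y + 1))\<^sup>2"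
proof (rule DERIV_imp_deriv)
  let ?A = "racah_wilson_A \<alpha> \<beta> \<gamma> \<delta>"
  have "((\<lambda>y. ?A (- \<i> * y)) has_field_derivative deriv ?A (- \<i> * y) * - \<i>) (at y)"
    by (rule DERIV_chain2[where f = ?A, OF wilson_A_differentiable])
      (auto intro!: derivative_eq_intros)
  moreover have "((\<lambda>y. 2 * y * (2 * y + 1)) has_field_derivative (8 * y + 2)) (at y)"
    by (auto intro!: derivative_eq_intros simp: algebra_simps)
  moreover have "2 * y * (2 * y + 1) \<noteq> 0" using assms by simp
  ultimately show "(racah_D \<alpha> \<beta> \<gamma> \<delta> has_field_derivative
    (- \<i> * deriv ?A (- \<i> * y) * (2 * y * (2 * y + 1)) - ?A (- \<i> * y) * (8 * y + 2))
      / (2 * y * (2 * y + 1))\<^sup>2) (at y)"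
    unfolding racah_D_eq[abs_def]
    by (rule DERIV_cong[OF DERIV_divide]) (simp add: power2_eq_square mult.commute)
qed

lemma racah_prod_eq: "racah_prod N u n E = wilson_prod N (\<lambda>s. - \<i> * u s) n E"
proof -
  have "(- \<i> * u n)\<^sup>2 - (- \<i> * u l)\<^sup>2 = - ((u n)\<^sup>2 - (u l)\<^sup>2)" for l
    by (simp add: power_mult_distrib)
  moreover have "2 * \<i> * (- \<i> * u n) = 2 * u n" by simp
  ultimately show ?thesis
    unfolding racah_prod_def wilson_prod_def
    by (simp only: minus_divide_right[symmetric] diff_minus_eq_add)
qed

lemma racah_Phi_eq:
  assumes "u n \<noteq> 0" "2 * u n + 1 \<noteq> 0"
  shows "racah_Phi N \<alpha> \<beta> \<gamma> \<delta> u n m =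
    - wilson_Phi N (racah_theta \<gamma> \<delta>) (racah_b \<gamma> \<delta>) (racah_c \<alpha> \<gamma> \<delta>) (racah_d \<beta> \<gamma> \<delta>)
      (\<lambda>s. - \<i> * u s) n m"
proof -
  define y where "y = u n"
  define A where "A = racah_wilson_A \<alpha> \<beta> \<gamma> \<delta> (- \<i> * y)"
  define A' where "A' = deriv (racah_wilson_A \<alpha> \<beta> \<gamma> \<delta>) (- \<i> * y)"
  \<comment> \<open>Kept as an atom in the algebra below.\<close>
  define e where "e = 2 * y + 1"
  define p where "p = wilson_prod N (\<lambda>s. - \<i> * u s) n"
  have y0: "y \<noteq> 0" and e0: "e \<noteq> 0" using assms by (auto simp: y_def e_def)
  have D: "racah_D \<alpha> \<beta> \<gamma> \<delta> y = A / (2 * y * e)"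
    by (simp add: racah_D_eq A_def y_def e_def)
  have D': "deriv (racah_D \<alpha> \<beta> \<gamma> \<delta>) y = (- \<i> * A' * (2 * y * e) - A * (4 * y + 2 * e)) / (2 * y * e)\<^sup>2"
    using deriv_racah_D[OF y0, of \<alpha> \<beta> \<gamma> \<delta>] e0
    by (simp add: A_def A'_def y_def e_def algebra_simps)
  have sq: "(- \<i> * z)\<^sup>2 = - z\<^sup>2" for z :: complex
    by (simp add: power_mult_distrib)
  have e': "1 + 2 * y = e" "1 + 2 * \<i> * (- \<i> * y) = e" by (simp_all add: e_def)
  show ?thesis
  proof (cases "m = n")
    case False
    have "- (1 / K\<^sup>2) * (t * (A / (2 * y * e)) / y) * e\<^sup>2 * r =
        - (- (1 / (2 * (- \<i> * y))\<^sup>2) * (2 * A) * (\<i> * (- \<i> * t) * e / K\<^sup>2) * r)"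
      for K t r :: complex
      using y0 e0 by (cases "K = 0") (simp_all add: power_mult_distrib field_simps power2_eq_square)
    moreover have "(- y\<^sup>2 - - t)\<^sup>2 = (y\<^sup>2 - t)\<^sup>2" for t
      by (simp add: power2_eq_square algebra_simps)
    ultimately show ?thesis
      using False
      unfolding racah_Phi_def wilson_Phi_def Let_def racah_prod_eq p_def[symmetric]
      unfolding y_def[symmetric] A_def[symmetric] sq e' D
      by simp
  next
    case True
    define S where "S = (\<Sum>k\<in>{..<N} - {n}. (y\<^sup>2 + (u k)\<^sup>2 + y) / (y\<^sup>2 - (u k)\<^sup>2)\<^sup>2 * p {n, k})"
    have S: "(\<Sum>k\<in>{..<N} - {n}. (\<i> * (- \<i> * y) - ((- \<i> * y)\<^sup>2 + (- \<i> * u k)\<^sup>2)) /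
        ((- \<i> * y)\<^sup>2 - (- \<i> * u k)\<^sup>2)\<^sup>2 * p {n, k}) = S"
      unfolding S_def
    proof (rule sum.cong[OF refl])
      fix k
      have "(- y\<^sup>2 - - (u k)\<^sup>2)\<^sup>2 = (y\<^sup>2 - (u k)\<^sup>2)\<^sup>2"
        by (simp add: power2_eq_square algebra_simps)
      moreover have "\<i> * (- \<i> * y) - (- y\<^sup>2 + - (u k)\<^sup>2) = y\<^sup>2 + (u k)\<^sup>2 + y" by simp
      ultimately show "(\<i> * (- \<i> * y) - ((- \<i> * y)\<^sup>2 + (- \<i> * u k)\<^sup>2)) /
        ((- \<i> * y)\<^sup>2 - (- \<i> * u k)\<^sup>2)\<^sup>2 * p {n, k} =
        (y\<^sup>2 + (u k)\<^sup>2 + y) / (y\<^sup>2 - (u k)\<^sup>2)\<^sup>2 * p {n, k}"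
        unfolding sq by simp
    qed
    have diag: "1 / 2 * (((A / (2 * y * e) / y\<^sup>2
          - (- \<i> * A' * (2 * y * e) - A * (4 * y + 2 * e)) / (2 * y * e)\<^sup>2 / y) * e
          - 2 * (A / (2 * y * e) / y)) * r + 2 * (A / (2 * y * e) / y) * e * S) =
        - (1 / (2 * (- \<i> * y))\<^sup>2 * ((2 * A / (\<i> * (- \<i> * y)) + \<i> * A') * r + 2 * A * S))"
      for r
      using y0 e0 by (simp add: power_mult_distrib field_simps power2_eq_square)
    show ?thesis
      unfolding racah_Phi_def wilson_Phi_def Let_def racah_prod_eq p_def[symmetric]
      unfolding y_def[symmetric] A_def[symmetric] A'_def[symmetric] e' D D' S_def[symmetric]
      by (simp only: True if_True simp_thms S diag)
  qed
qed

lemma racah_matrix_eq: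
  assumes "racah_admissible N \<alpha> \<beta> \<gamma> \<delta>" "racah_nodes N \<alpha> \<beta> \<gamma> \<delta> y"
  shows "racah_matrix N \<alpha> \<beta> \<gamma> \<delta> y =
    - wilson_matrix N (racah_theta \<gamma> \<delta>) (racah_b \<gamma> \<delta>) (racah_c \<alpha> \<gamma> \<delta>) (racah_d \<beta> \<gamma> \<delta>)
      (\<lambda>s. - \<i> * y s)"
proof (rule eq_matI)
  fix n m
  assume "n < dim_row (- wilson_matrix N (racah_theta \<gamma> \<delta>) (racah_b \<gamma> \<delta>) (racah_c \<alpha> \<gamma> \<delta>)
      (racah_d \<beta> \<gamma> \<delta>) (\<lambda>s. - \<i> * y s))"
    and "m < dim_col (- wilson_matrix N (racah_theta \<gamma> \<delta>) (racah_b \<gamma> \<delta>) (racah_c \<alpha> \<gamma> \<delta>)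
      (racah_d \<beta> \<gamma> \<delta>) (\<lambda>s. - \<i> * y s))"
  then have n: "n < N" and m: "m < N" by (auto simp: wilson_matrix_def)
  have "poly (racah_poly N \<alpha> \<beta> \<gamma> \<delta>) ((y n)\<^sup>2 - (racah_theta \<gamma> \<delta>)\<^sup>2) = 0"
    using assms(2) n unfolding racah_nodes_def by (auto dest: bij_betwE)
  then have "y n \<notin> {0, 1 / 2, - 1 / 2}"
    using assms(1) unfolding racah_admissible_def by blast
  moreover have "z = - 1 / 2" if "2 * z + 1 = 0" for z :: complex
  proof -
    have "z = (2 * z + 1 - 1) / 2" by simp
    also have "\<dots> = - 1 / 2" unfolding that by simp
    finally show ?thesis .
  qed
  from this[of "y n"] this[of "- y n"]
  have "2 * y n + 1 = 0 \<Longrightarrow> y n = - 1 / 2" "2 * - y n + 1 = 0 \<Longrightarrow> y n = 1 / 2"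
    by (auto simp: minus_equation_iff)
  ultimately have "y n \<noteq> 0" "2 * y n + 1 \<noteq> 0" "2 * - y n + 1 \<noteq> 0"
    by blast+
  then show "racah_matrix N \<alpha> \<beta> \<gamma> \<delta> y $$ (n, m) =
      (- wilson_matrix N (racah_theta \<gamma> \<delta>) (racah_b \<gamma> \<delta>) (racah_c \<alpha> \<gamma> \<delta>) (racah_d \<beta> \<gamma> \<delta>)
        (\<lambda>s. - \<i> * y s)) $$ (n, m)"
    using n m racah_Phi_eq[of y n N \<alpha> \<beta> \<gamma> \<delta> m] racah_Phi_eq[of "\<lambda>s. - y s" n N \<alpha> \<beta> \<gamma> \<delta> m]
    by (simp add: racah_matrix_def wilson_matrix_def)
qed (simp_all add: racah_matrix_def wilson_matrix_def)

lemma eigenvalue_uminus_mat: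
  fixes M :: "'a::comm_ring_1 mat"
  assumes M: "M \<in> carrier_mat N N" and ev: "eigenvalue (- M) k"
  shows "eigenvalue M (- k)"
proof -
  obtain v where v: "v \<in> carrier_vec N" "v \<noteq> 0\<^sub>v N" "(- M) *\<^sub>v v = k \<cdot>\<^sub>v v"
    using M ev unfolding eigenvalue_def eigenvector_def by auto
  have "M *\<^sub>v v = (- k) \<cdot>\<^sub>v v"
  proof (rule eq_vecI)
    fix i assume "i < dim_vec ((- k) \<cdot>\<^sub>v v)"
    then have i: "i < N" using v(1) by simp
    have "((- M) *\<^sub>v v) $ i = k * v $ i" using v(1) i by (simp add: v(3))
    moreover have "((- M) *\<^sub>v v) $ i = - ((M *\<^sub>v v) $ i)"
      using M i v(1) by (simp add: scalar_prod_def sum_negf)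
    ultimately show "(M *\<^sub>v v) $ i = ((- k) \<cdot>\<^sub>v v) $ i"
      using v(1) i by (simp add: minus_equation_iff)
  qed (use M v(1) in auto)
  then show ?thesis
    using M v(1,2) unfolding eigenvalue_def eigenvector_def by auto
qed

lemma racah_matrix_eigenvalue:
  assumes adm: "racah_admissible N \<alpha> \<beta> \<gamma> \<delta>" and nodes: "racah_nodes N \<alpha> \<beta> \<gamma> \<delta> y"
    and ev: "eigenvalue (racah_matrix N \<alpha> \<beta> \<gamma> \<delta> y) k"
  shows "\<exists>j<N. k = wilson_ev (\<alpha> + \<beta> + 2) j - wilson_ev (\<alpha> + \<beta> + 2) N"
proof -
  have "eigenvalue (wilson_matrix N (racah_theta \<gamma> \<delta>) (racah_b \<gamma> \<delta>) (racah_c \<alpha> \<gamma> \<delta>) (racah_d \<beta> \<gamma> \<delta>)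
      (\<lambda>s. - \<i> * y s)) (- k)"
    using ev unfolding racah_matrix_eq[OF adm nodes]
    by (rule eigenvalue_uminus_mat[where N = N, rotated]) (simp add: wilson_matrix_def)
  then obtain j where "j < N" "- k = wilson_ev (\<alpha> + \<beta> + 2) N - wilson_ev (\<alpha> + \<beta> + 2) j"
    using wilson_matrix_eigenvalue[OF racah_admissible_imp_wilson[OF adm]
        racah_nodes_imp_wilson[OF adm nodes]]
    unfolding racah_params(4) by blast
  then show ?thesis
    by (intro exI[of _ j]) (simp add: minus_equation_iff[of k])
qed

section \<open>Integrality and rationality of the eigenvalues\<close>

lemma wilson_ev_Ints: "s \<in> \<int> \<Longrightarrow> wilson_ev s k \<in> \<int>"
  by (simp add: wilson_ev_def)

lemma wilson_ev_Rats: "s \<in> \<rat> \<Longrightarrow> wilson_ev s k \<in> \<rat>"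
  by (simp add: wilson_ev_def)

theorem corollary2p3:
  fixes N :: nat
  assumes "N \<ge> 1"
  shows
    "(\<forall>(a::complex) b c d (x :: nat \<Rightarrow> complex).
        wilson_admissible N a b c d \<longrightarrow> wilson_nodes N a b c d x \<longrightarrow>
          (a + b + c + d \<in> \<int> \<longrightarrow> (\<forall>k. eigenvalue (wilson_matrix N a b c d x) k \<longrightarrow> k \<in> \<int>)) \<and>
          (a + b + c + d \<in> \<rat> \<longrightarrow> (\<forall>k. eigenvalue (wilson_matrix N a b c d x) k \<longrightarrow> k \<in> \<rat>)))
     \<and>
     (\<forall>(\<alpha>::complex) \<beta> \<gamma> \<delta> (y :: nat \<Rightarrow> complex).
        racah_admissible N \<alpha> \<beta> \<gamma> \<delta> \<longrightarrow> racah_nodes N \<alpha> \<beta> \<gamma> \<delta> y \<longrightarrow>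
          (\<alpha> + \<beta> \<in> \<int> \<longrightarrow> (\<forall>k. eigenvalue (racah_matrix N \<alpha> \<beta> \<gamma> \<delta> y) k \<longrightarrow> k \<in> \<int>)) \<and>
          (\<alpha> + \<beta> \<in> \<rat> \<longrightarrow> (\<forall>k. eigenvalue (racah_matrix N \<alpha> \<beta> \<gamma> \<delta> y) k \<longrightarrow> k \<in> \<rat>)))"
proof (intro conjI allI impI)
  fix a b c d :: complex and x k
  assume adm: "wilson_admissible N a b c d" "wilson_nodes N a b c d x"
    and ev: "eigenvalue (wilson_matrix N a b c d x) k"
  from wilson_matrix_eigenvalue[OF adm ev]
  show "a + b + c + d \<in> \<int> \<Longrightarrow> k \<in> \<int>" "a + b + c + d \<in> \<rat> \<Longrightarrow> k \<in> \<rat>"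
    by (auto intro!: Ints_diff Rats_diff wilson_ev_Ints wilson_ev_Rats)
next
  fix \<alpha> \<beta> \<gamma> \<delta> :: complex and y k
  assume adm: "racah_admissible N \<alpha> \<beta> \<gamma> \<delta>" "racah_nodes N \<alpha> \<beta> \<gamma> \<delta> y"
    and ev: "eigenvalue (racah_matrix N \<alpha> \<beta> \<gamma> \<delta> y) k"
  from racah_matrix_eigenvalue[OF adm ev]
  show "\<alpha> + \<beta> \<in> \<int> \<Longrightarrow> k \<in> \<int>" "\<alpha> + \<beta> \<in> \<rat> \<Longrightarrow> k \<in> \<rat>"
    by (auto intro!: Ints_diff Rats_diff wilson_ev_Ints wilson_ev_Rats
      intro: Ints_add[of "\<alpha> + \<beta>" 2] Rats_add[of "\<alpha> + \<beta>" 2])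
qed

end
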